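(* Let $\gamma,\epsilon\in(0,1)$ with $\gamma\geq\epsilon^2$. There exists an efficient randomized procedure that takes as input a $(1-\epsilon,1-\gamma)$-\textsc{StrongBipartiteUniqueGames} instance $G=(V_L,V_R,E,[k],\{\pi_{v\to u}\},\mu)$ which is left $d$-regular and right uniform (i.e. $\Pr_{u\sim\mu}[v\in N_G(u)]=d/|V_R|$ for every $v\in V_R$), and outputs a \textsc{StrongBipartiteUniqueGames} instance $G''=(V_L'',V_R',E'',[k],\{\pi_{v\to u}\},\mu')$ such that the left degree of $G''$ is at most $d$, the right degree is at most $D=C''d\ell$ where $\ell=C''\epsilon^{-2}\log k$ (for some large enough constant $C''>0$), $\mu'$ is the uniform distribution on $V_L''$, and: \begin{itemize} \item if $G$ is a YES instance, then there exist a subset $S\subseteq V_L''$ with $\mu'(S)\geq 1-4\epsilon$ and a labeling of the vertices of $G''$ such that all constraints incident on $S$ are satisfied; \item if $G$ is a NO instance, then for any labeling of the vertices of $G''$, at most a $(1-\gamma/4)$-fraction of left vertices (w.r.t. $\mu'$) have all constraints incident on them satisfied. \end{itemize}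
   Context: A \textsc{StrongBipartiteUniqueGames} instance $G(V_L,V_R,E,[k],\{\pi_{v\to u}\},\mu)$ consists of a bipartite multigraph with left vertices $V_L$, right vertices $V_R$, a bijection $\pi_{v\to u}:[k]\to[k]$ on each edge $(u,v)$ with $u\in V_L$, $v\in V_R$, and a measure $\mu$ on $V_L$; a labeling $\sigma:V_L\cup V_R\to[k]$ satisfies edge $(u,v)$ if $\sigma(u)=\pi_{v\to u}(\sigma(v))$. A $(1-\epsilon,1-\gamma)$-instance is promised to be YES (some labeling has $\Pr_{u\sim\mu}[\text{all edges at }u\text{ satisfied}]\geq 1-\epsilon$) or NO (every labeling has this probability $<1-\gamma$). *)

theory Defs
  imports "HOL-Probability.Probability"
begin

section \<open>Strong bipartite unique games\<close>

text \<open>The left vertices are \<open>{..<nleft G}\<close>, the right vertices \<open>{..<nright G}\<close> and the label set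
  \<open>[k]\<close> is \<open>{..<alphabet G}\<close>. An edge \<open>(u, v, p)\<close> carries the bijection \<open>p\<close> taking labels of \<open>v\<close> to
  labels of \<open>u\<close>; edges form a list, so parallel edges are allowed and counted with multiplicity.\<close>

record sbug =
  nleft :: nat
  nright :: nat
  alphabet :: nat
  edges :: "(nat \<times> nat \<times> (nat \<Rightarrow> nat)) list"
  mu :: "nat pmf"

definition sbug_instance :: "sbug \<Rightarrow> bool" where
  "sbug_instance G \<longleftrightarrow>
     0 < alphabet G \<and>
     (\<forall>(u, v, p) \<in> set (edges G).
        u < nleft G \<and> v < nright G \<and> bij_betw p {..<alphabet G} {..<alphabet G}) \<and>
     set_pmf (mu G) \<subseteq> {..<nleft G}"

definition neighbours :: "sbug \<Rightarrow> nat \<Rightarrow> nat set" where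
  "neighbours G u = {v. \<exists>p. (u, v, p) \<in> set (edges G)}"

definition left_degree :: "sbug \<Rightarrow> nat \<Rightarrow> nat" where
  "left_degree G u = length (filter (\<lambda>(u', v, p). u' = u) (edges G))"

definition right_degree :: "sbug \<Rightarrow> nat \<Rightarrow> nat" where
  "right_degree G v = length (filter (\<lambda>(u, v', p). v' = v) (edges G))"

definition left_regular :: "nat \<Rightarrow> sbug \<Rightarrow> bool" where
  "left_regular d G \<longleftrightarrow> (\<forall>u < nleft G. left_degree G u = d)"

definition right_uniform :: "nat \<Rightarrow> sbug \<Rightarrow> bool" where
  "right_uniform d G \<longleftrightarrow>
     (\<forall>v < nright G. measure_pmf.prob (mu G) {u. v \<in> neighbours G u} = real d / real (nright G))"

text \<open>\<open>Inl u\<close> is a left vertex and \<open>Inr v\<close> a right vertex.\<close>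

definition labeling :: "sbug \<Rightarrow> (nat + nat \<Rightarrow> nat) \<Rightarrow> bool" where
  "labeling G \<sigma> \<longleftrightarrow> \<sigma> \<in> ({..<nleft G} <+> {..<nright G}) \<rightarrow> {..<alphabet G}"

definition all_satisfied :: "sbug \<Rightarrow> (nat + nat \<Rightarrow> nat) \<Rightarrow> nat \<Rightarrow> bool" where
  "all_satisfied G \<sigma> u \<longleftrightarrow>
     (\<forall>(u', v, p) \<in> set (edges G). u' = u \<longrightarrow> \<sigma> (Inl u) = p (\<sigma> (Inr v)))"

definition yes_instance :: "real \<Rightarrow> sbug \<Rightarrow> bool" where
  "yes_instance \<epsilon> G \<longleftrightarrow>
     (\<exists>\<sigma>. labeling G \<sigma> \<and> measure_pmf.prob (mu G) {u. all_satisfied G \<sigma> u} \<ge> 1 - \<epsilon>)"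

definition no_instance :: "real \<Rightarrow> sbug \<Rightarrow> bool" where
  "no_instance \<gamma> G \<longleftrightarrow>
     (\<forall>\<sigma>. labeling G \<sigma> \<longrightarrow> measure_pmf.prob (mu G) {u. all_satisfied G \<sigma> u} < 1 - \<gamma>)"

definition promise_instance :: "real \<Rightarrow> real \<Rightarrow> sbug \<Rightarrow> bool" where
  "promise_instance \<epsilon> \<gamma> G \<longleftrightarrow> sbug_instance G \<and> (yes_instance \<epsilon> G \<or> no_instance \<gamma> G)"


section \<open>Randomized polynomial time\<close>

text \<open>The model of computation is a variable-free form of Jones's WHILE language on binary trees.
  In \<open>exec P x y t\<close> the program \<open>P\<close> maps input \<open>x\<close> to output \<open>y\<close> at cost \<open>t\<close>. Elementary programs
  are charged for reading their whole input, so every tree built in a run has size at most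
  \<open>size x + t\<close>. Hence the cost is polynomially related to the running time of a Turing machine,
  although values may be copied.\<close>

datatype tree = Atom | Node tree tree

datatype program =
    Skip | Empty | Hd | Tl
  | Join program program
  | Seq program program
  | Cond program program program
  | While program program

inductive exec :: "program \<Rightarrow> tree \<Rightarrow> tree \<Rightarrow> nat \<Rightarrow> bool" where
  skip: "exec Skip x x (Suc (size x))"
| empty: "exec Empty x Atom (Suc (size x))"
| hd_atom: "exec Hd Atom Atom (Suc (size Atom))"
| hd_node: "exec Hd (Node a b) a (Suc (size (Node a b)))"
| tl_atom: "exec Tl Atom Atom (Suc (size Atom))"
| tl_node: "exec Tl (Node a b) b (Suc (size (Node a b)))"
| join: "exec P x a s \<Longrightarrow> exec Q x b t \<Longrightarrow> exec (Join P Q) x (Node a b) (Suc (s + t))"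
| seq: "exec P x y s \<Longrightarrow> exec Q y z t \<Longrightarrow> exec (Seq P Q) x z (Suc (s + t))"
| cond_true: "exec B x (Node a b) s \<Longrightarrow> exec P x y t \<Longrightarrow> exec (Cond B P Q) x y (Suc (s + t))"
| cond_false: "exec B x Atom s \<Longrightarrow> exec Q x y t \<Longrightarrow> exec (Cond B P Q) x y (Suc (s + t))"
| while_stop: "exec B x Atom s \<Longrightarrow> exec (While B P) x x (Suc (s + size x))"
| while_step: "exec B x (Node a b) s \<Longrightarrow> exec P x y t \<Longrightarrow> exec (While B P) y z r \<Longrightarrow>
    exec (While B P) x z (Suc (s + t + r))"

text \<open>Every polynomial is bounded by \<open>\<lambda>n. n ^ c + c\<close> for some \<open>c\<close>.\<close>

definition polynomial_time :: "(tree \<Rightarrow> tree) \<Rightarrow> bool" where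
  "polynomial_time F \<longleftrightarrow> (\<exists>P c. \<forall>x. \<exists>t. exec P x (F x) t \<and> t \<le> size x ^ c + c)"

primrec enc_list :: "tree list \<Rightarrow> tree" where
  "enc_list [] = Atom"
| "enc_list (x # xs) = Node x (enc_list xs)"

definition enc_bits :: "bool list \<Rightarrow> tree" where
  "enc_bits bs = enc_list (map (\<lambda>b. if b then Node Atom Atom else Atom) bs)"

definition efficient_randomized :: "(tree \<Rightarrow> tree pmf) \<Rightarrow> bool" where
  "efficient_randomized A \<longleftrightarrow>
     (\<exists>F c. polynomial_time F \<and>
        (\<forall>x. A x = map_pmf (\<lambda>r. F (Node x (enc_bits r)))
                     (pmf_of_set {r. length r = size x ^ c + c})))"


section \<open>Encoding of instances\<close>

text \<open>Vertices and labels are written in unary, which is harmless because vertex sets and tables of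
  permutations are listed explicitly. The distribution is given by integer weights written in
  binary, least significant bit first; the probability of \<open>u\<close> is its weight divided by the total.\<close>

definition enc_nat :: "nat \<Rightarrow> tree" where
  "enc_nat n = enc_list (replicate n Atom)"

definition enc_edge :: "nat \<Rightarrow> nat \<times> nat \<times> (nat \<Rightarrow> nat) \<Rightarrow> tree" where
  "enc_edge k = (\<lambda>(u, v, p).
     enc_list [enc_nat u, enc_nat v, enc_list (map (\<lambda>i. enc_nat (p i)) [0..<k])])"

definition encodes :: "tree \<Rightarrow> sbug \<Rightarrow> bool" where
  "encodes x G \<longleftrightarrow>
     (\<exists>ws :: bool list list.
        let weight = (\<lambda>u. horner_sum of_bool 2 (ws ! u) :: nat) in
        length ws = nleft G \<and>
        (\<forall>u < nleft G.
           pmf (mu G) u = real (weight u) / real (\<Sum>u' < nleft G. weight u')) \<and>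
        x = enc_list
              [enc_nat (nleft G), enc_nat (nright G), enc_nat (alphabet G),
               enc_list (map (enc_edge (alphabet G)) (edges G)),
               enc_list (map enc_bits ws)])"


section \<open>Guarantees on the output\<close>

definition bounded_degree_output :: "nat \<Rightarrow> real \<Rightarrow> sbug \<Rightarrow> sbug \<Rightarrow> bool" where
  "bounded_degree_output d D G H \<longleftrightarrow>
     sbug_instance H \<and> alphabet H = alphabet G \<and>
     (\<forall>u < nleft H. left_degree H u \<le> d) \<and>
     (\<forall>v < nright H. real (right_degree H v) \<le> D) \<and>
     mu H = pmf_of_set {..<nleft H}"

definition completeness :: "real \<Rightarrow> sbug \<Rightarrow> sbug \<Rightarrow> bool" where
  "completeness \<epsilon> G H \<longleftrightarrow>
     (yes_instance \<epsilon> G \<longrightarrow>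
       (\<exists>S \<sigma>. S \<subseteq> {..<nleft H} \<and> measure_pmf.prob (mu H) S \<ge> 1 - 4 * \<epsilon> \<and>
              labeling H \<sigma> \<and> (\<forall>u \<in> S. all_satisfied H \<sigma> u)))"

definition soundness :: "real \<Rightarrow> sbug \<Rightarrow> sbug \<Rightarrow> bool" where
  "soundness \<gamma> G H \<longleftrightarrow>
     (no_instance \<gamma> G \<longrightarrow>
       (\<forall>\<sigma>. labeling H \<sigma> \<longrightarrow>
          measure_pmf.prob (mu H) {u. all_satisfied H \<sigma> u} \<le> 1 - \<gamma> / 4))"

end

theory Submission
  imports Defs
begin

text \<open>Sample \<open>m = c b n\<close> left vertices independently from the given measure, where \<open>n\<close> is the number
  of right vertices, \<open>b\<close> is about \<open>log k\<close> and \<open>c\<close> is about \<open>\<epsilon>\<^sup>-\<^sup>2\<close>, and drop all edges at right vertices that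
  received more than five times their expected number \<open>d c b\<close> of edges. For a NO instance, a
  multiplicative Chernoff bound with \<open>\<gamma> \<ge> \<epsilon>\<^sup>2\<close> beats the union bound over the \<open>k\<^sup>n\<close> labelings of the right
  side; for a YES instance, a Chernoff bound for one labeling suffices; and the expected number of
  edges dropped is at most \<open>n\<close>, which is a negligible fraction of \<open>m\<close>. All three bounds are exponential
  moments of a number of occurrences, with bases \<open>1/2\<close>, \<open>2\<close> and \<open>4\<close>.

  Weights are written in binary, so samples are drawn by rejection: a uniform number with as many bits
  as the total weight is located among the prefix sums of the weights, and is rejected with
  probability at most \<open>1/2\<close>. If \<open>8 m\<close> draws do not yield \<open>m\<close> samples, the output is an instance
  without edges.\<close>

subsection \<open>Trees as lists\<close>

text \<open>The degree bounds have to hold for every random tape, whereas completeness and soundness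
  are only asked for with probability \<open>1 - \<delta>\<close>. This is why edges at overloaded
  right vertices are removed instead of hoping that none exist. Removal never hurts completeness;
  for soundness, a sample that loses an edge is simply counted as satisfied. The budget for a NO
  instance is: violated mass at least \<gamma> under \<open>mu\<close>, half of it kept by the
  sample, another \<gamma>/4 given up to removed edges, so \<gamma>/4 remains. The union bound runs
  over right labelings only, because each left vertex can choose its best label on its own once its
  neighbours are labeled. It closes since \<open>c * \<gamma>\<close> is at least a large constant
  \<open>K\<close>, so the Chernoff exponent is a multiple of \<open>K * b * n\<close> and exceeds
  \<open>n * ln k\<close>. The number \<open>c\<close> depends on \<epsilon> and \<delta> alone and
  is hardwired into the program; the degree \<open>d\<close> is not part of the input and is read
  off from a vertex.\<close>

fun thd :: "tree \<Rightarrow> tree" where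
  "thd Atom = Atom"
| "thd (Node a b) = a"

fun ttl :: "tree \<Rightarrow> tree" where
  "ttl Atom = Atom"
| "ttl (Node a b) = b"

fun dec :: "tree \<Rightarrow> tree list" where
  "dec Atom = []"
| "dec (Node a b) = a # dec b"

text \<open>Tests in \<open>exec\<close> treat \<open>Atom\<close> as false and every other tree as
  true; with \<open>tbit\<close>, deciding a predicate is a special case of computing a function on
  trees.\<close>

definition tbit :: "bool \<Rightarrow> tree" where
  "tbit b = (if b then Node Atom Atom else Atom)"

lemma tbit_eq_Atom [simp]: "tbit b = Atom \<longleftrightarrow> \<not> b"
  by (simp add: tbit_def)

lemma size_tbit_le: "size (tbit b) \<le> 1"
  by (simp add: tbit_def)

lemma dec_enc_list [simp]: "dec (enc_list xs) = xs"
  by (induction xs) auto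

lemma enc_list_dec [simp]: "enc_list (dec t) = t"
  by (induction t rule: dec.induct) auto

lemma enc_list_eq_Atom [simp]: "enc_list xs = Atom \<longleftrightarrow> xs = []"
  by (cases xs) auto

lemma dec_eq_Nil [simp]: "dec t = [] \<longleftrightarrow> t = Atom"
  by (cases t) auto

lemma size_thd_le: "size (thd t) \<le> size t"
  by (cases t) auto

lemma size_ttl_le: "size (ttl t) \<le> size t"
  by (cases t) auto

lemma length_dec_le: "length (dec t) \<le> size t"
  by (induction t rule: dec.induct) auto

lemma size_in_dec: "a \<in> set (dec t) \<Longrightarrow> size a \<le> size t"
  by (induction t rule: dec.induct) auto

subsection \<open>Polynomial bounds\<close>

text \<open>The base \<open>n + 2\<close> is at least 2 even at \<open>n = 0\<close>, so constants
  and the factor 2 arising from a sum can be absorbed into the exponent.\<close>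

definition poly_bounded :: "(nat \<Rightarrow> nat) \<Rightarrow> bool" where
  "poly_bounded q \<longleftrightarrow> (\<exists>c. \<forall>n. q n \<le> (n + 2) ^ c)"

lemma poly_boundedI: "(\<And>n. q n \<le> (n + 2) ^ c) \<Longrightarrow> poly_bounded q"
  unfolding poly_bounded_def by blast

lemma poly_bounded_mono: "poly_bounded q \<Longrightarrow> (\<And>n. p n \<le> q n) \<Longrightarrow> poly_bounded p"
  unfolding poly_bounded_def by (meson order_trans)

lemma poly_bounded_id: "poly_bounded (\<lambda>n. n)"
  by (rule poly_boundedI[where c = 1]) simp

lemma poly_bounded_const: "poly_bounded (\<lambda>n. k)"
proof (rule poly_boundedI[where c = k])
  fix n :: nat
  have "k \<le> 2 ^ k" by (rule less_imp_le) (rule less_exp)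
  also have "\<dots> \<le> (n + 2) ^ k" by (rule power_mono) auto
  finally show "k \<le> (n + 2) ^ k" .
qed

lemma poly_bounded_add:
  assumes "poly_bounded p" "poly_bounded q"
  shows "poly_bounded (\<lambda>n. p n + q n)"
proof -
  obtain a b where a: "\<And>n. p n \<le> (n + 2) ^ a" and b: "\<And>n. q n \<le> (n + 2) ^ b"
    using assms unfolding poly_bounded_def by blast
  show ?thesis
  proof (rule poly_boundedI[where c = "Suc (a + b)"])
    fix n :: nat
    have "p n \<le> (n + 2) ^ (a + b)" "q n \<le> (n + 2) ^ (a + b)"
      using a[of n] b[of n] power_increasing[of a "a + b" "n + 2"] power_increasing[of b "a + b" "n + 2"]
      by linarith+
    hence "p n + q n \<le> 2 * (n + 2) ^ (a + b)" by simp
    also have "\<dots> \<le> (n + 2) * (n + 2) ^ (a + b)" by (rule mult_right_mono) auto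
    finally show "p n + q n \<le> (n + 2) ^ Suc (a + b)" by simp
  qed
qed

lemma poly_bounded_mult:
  assumes "poly_bounded p" "poly_bounded q"
  shows "poly_bounded (\<lambda>n. p n * q n)"
proof -
  obtain a b where a: "\<And>n. p n \<le> (n + 2) ^ a" and b: "\<And>n. q n \<le> (n + 2) ^ b"
    using assms unfolding poly_bounded_def by blast
  show ?thesis
    by (rule poly_boundedI[where c = "a + b"]) (simp only: power_add mult_mono[OF a b] zero_le)
qed

lemma poly_bounded_power: "poly_bounded p \<Longrightarrow> poly_bounded (\<lambda>n. p n ^ c)"
  by (induction c) (auto intro: poly_bounded_const poly_bounded_mult)

lemmas poly_bounded_intros =
  poly_bounded_const poly_bounded_id poly_bounded_add poly_bounded_mult poly_bounded_power

lemma poly_bounded_Suc: "poly_bounded p \<Longrightarrow> poly_bounded (\<lambda>n. Suc (p n))"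
  using poly_bounded_add[OF _ poly_bounded_const[of 1]] by simp

subsection \<open>Closure properties of polynomial time\<close>

text \<open>Every elementary step is charged for its whole input, so time bounds output size. This
  is what makes composition of polynomial-time programs polynomial.\<close>

lemma exec_size_le: "exec P x y t \<Longrightarrow> size y \<le> t"
  by (induction rule: exec.induct) auto

lemma polynomial_timeI:
  assumes "\<And>x. \<exists>t. exec P x (F x) t \<and> t \<le> q (size x)" and "poly_bounded q"
  shows "polynomial_time F"
proof -
  obtain a where a: "\<And>n. q n \<le> (n + 2) ^ a"
    using assms(2) unfolding poly_bounded_def by blast
  \<comment> \<open>The summand \<open>3 ^ a\<close> covers \<open>n \<le> 1\<close>; for larger
    \<open>n\<close> one has \<open>n + 2 \<le> n * n\<close>, which doubles the exponent.\<close>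
  define c where "c = 3 ^ a + 2 * a"
  have "(n + 2) ^ a \<le> n ^ c + c" for n :: nat
  proof (cases "n \<le> 1")
    case True
    hence "(n + 2) ^ a \<le> 3 ^ a" by (intro power_mono) auto
    thus ?thesis by (simp add: c_def)
  next
    case False
    hence "n + 2 \<le> n * n"
      using mult_le_mono1[of 2 n n] by linarith
    hence "n + 2 \<le> n\<^sup>2" by (simp add: power2_eq_square)
    hence "(n + 2) ^ a \<le> (n\<^sup>2) ^ a" by (intro power_mono) auto
    also have "\<dots> = n ^ (2 * a)" by (simp add: power_mult)
    also have "\<dots> \<le> n ^ c" using False by (intro power_increasing) (auto simp: c_def)
    finally show ?thesis by simp
  qed
  with assms(1) a show ?thesis unfolding polynomial_time_def by (meson order_trans)
qed

lemma polynomial_timeE: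
  assumes "polynomial_time F"
  obtains P q where "\<And>x. \<exists>t. exec P x (F x) t \<and> t \<le> q (size x)" "poly_bounded q" "mono q"
proof -
  obtain P c where "\<And>x. \<exists>t. exec P x (F x) t \<and> t \<le> size x ^ c + c"
    using assms unfolding polynomial_time_def by blast
  moreover have "poly_bounded (\<lambda>n. n ^ c + c)" by (intro poly_bounded_intros)
  moreover have "mono (\<lambda>n::nat. n ^ c + c)" by (intro monoI) (simp add: power_mono)
  ultimately show ?thesis by (rule that)
qed

lemma polynomial_time_size:
  assumes "polynomial_time F"
  obtains q where "\<And>x. size (F x) \<le> q (size x)" "poly_bounded q" "mono q"
  using assms exec_size_le by (elim polynomial_timeE) (meson order_trans)

lemma poly_bounded_comp:
  assumes "poly_bounded p" "poly_bounded q" "mono p"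
  shows "poly_bounded (\<lambda>n. p (q n))"
proof -
  obtain a where a: "\<And>n. p n \<le> (n + 2) ^ a"
    using assms unfolding poly_bounded_def by blast
  show ?thesis
    by (rule poly_bounded_mono[OF _ a]) (intro poly_bounded_intros assms)
qed

lemma polynomial_time_id: "polynomial_time (\<lambda>x. x)"
  by (rule polynomial_timeI[where P = Skip and q = "\<lambda>n. Suc n"])
    (auto intro: exec.intros poly_bounded_Suc poly_bounded_id)

lemma polynomial_time_Atom: "polynomial_time (\<lambda>x. Atom)"
  by (rule polynomial_timeI[where P = Empty and q = "\<lambda>n. Suc n"])
    (auto intro: exec.intros poly_bounded_Suc poly_bounded_id)

lemma polynomial_time_Node:
  assumes "polynomial_time F" "polynomial_time G"
  shows "polynomial_time (\<lambda>x. Node (F x) (G x))"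
proof -
  obtain P p where P: "\<And>x. \<exists>t. exec P x (F x) t \<and> t \<le> p (size x)" "poly_bounded p"
    using assms(1) by (elim polynomial_timeE) blast
  obtain Q q where Q: "\<And>x. \<exists>t. exec Q x (G x) t \<and> t \<le> q (size x)" "poly_bounded q"
    using assms(2) by (elim polynomial_timeE) blast
  show ?thesis
  proof (rule polynomial_timeI[where P = "Join P Q" and q = "\<lambda>n. Suc (p n + q n)"])
    fix x
    obtain s t where "exec P x (F x) s" "s \<le> p (size x)" "exec Q x (G x) t" "t \<le> q (size x)"
      using P Q by blast
    thus "\<exists>t. exec (Join P Q) x (Node (F x) (G x)) t \<and> t \<le> Suc (p (size x) + q (size x))"
      by (intro exI[of _ "Suc (s + t)"] conjI join) auto
  qed (intro poly_bounded_Suc poly_bounded_intros P Q)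
qed

lemma polynomial_time_comp:
  assumes "polynomial_time G" "polynomial_time F"
  shows "polynomial_time (\<lambda>x. G (F x))"
proof -
  obtain P p where P: "\<And>x. \<exists>t. exec P x (F x) t \<and> t \<le> p (size x)" "poly_bounded p"
    using assms(2) by (elim polynomial_timeE) blast
  obtain Q q where Q: "\<And>x. \<exists>t. exec Q x (G x) t \<and> t \<le> q (size x)" "poly_bounded q" "mono q"
    using assms(1) by (elim polynomial_timeE) blast
  show ?thesis
  proof (rule polynomial_timeI[where P = "Seq P Q" and q = "\<lambda>n. Suc (p n + q (p n))"])
    fix x
    obtain s t where s: "exec P x (F x) s" "s \<le> p (size x)"
      and t: "exec Q (F x) (G (F x)) t" "t \<le> q (size (F x))"
      using P Q by meson
    have "q (size (F x)) \<le> q (p (size x))"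
      using exec_size_le[OF s(1)] s(2) Q(3) by (simp add: mono_def)
    with s t show "\<exists>t. exec (Seq P Q) x (G (F x)) t \<and> t \<le> Suc (p (size x) + q (p (size x)))"
      by (intro exI[of _ "Suc (s + t)"] conjI seq) auto
  qed (intro poly_bounded_Suc poly_bounded_intros poly_bounded_comp[OF Q(2)] P Q)
qed

lemma polynomial_time_const: "polynomial_time (\<lambda>x. c)"
  by (induction c) (auto intro: polynomial_time_Atom polynomial_time_Node)

lemma polynomial_time_thd_id: "polynomial_time thd"
proof (rule polynomial_timeI[where P = Hd and q = "\<lambda>n. Suc n"])
  fix x show "\<exists>t. exec Hd x (thd x) t \<and> t \<le> Suc (size x)"
    by (cases x) (metis hd_atom thd.simps(1) order_refl, metis hd_node thd.simps(2) order_refl)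
qed (intro poly_bounded_Suc poly_bounded_id)

lemma polynomial_time_ttl_id: "polynomial_time ttl"
proof (rule polynomial_timeI[where P = Tl and q = "\<lambda>n. Suc n"])
  fix x show "\<exists>t. exec Tl x (ttl x) t \<and> t \<le> Suc (size x)"
    by (cases x) (metis tl_atom ttl.simps(1) order_refl, metis tl_node ttl.simps(2) order_refl)
qed (intro poly_bounded_Suc poly_bounded_id)

lemmas polynomial_time_thd = polynomial_time_comp[OF polynomial_time_thd_id]
lemmas polynomial_time_ttl = polynomial_time_comp[OF polynomial_time_ttl_id]

lemma polynomial_time_if_Atom:
  assumes "polynomial_time B" "polynomial_time F" "polynomial_time G"
  shows "polynomial_time (\<lambda>x. if B x = Atom then G x else F x)"
proof -
  obtain P p where P: "\<And>x. \<exists>t. exec P x (F x) t \<and> t \<le> p (size x)" "poly_bounded p"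
    using assms(2) by (elim polynomial_timeE) blast
  obtain Q q where Q: "\<And>x. \<exists>t. exec Q x (G x) t \<and> t \<le> q (size x)" "poly_bounded q"
    using assms(3) by (elim polynomial_timeE) blast
  obtain R r where R: "\<And>x. \<exists>t. exec R x (B x) t \<and> t \<le> r (size x)" "poly_bounded r"
    using assms(1) by (elim polynomial_timeE) blast
  show ?thesis
  proof (rule polynomial_timeI[where P = "Cond R P Q" and q = "\<lambda>n. Suc (r n + (p n + q n))"])
    fix x
    obtain s t u where *: "exec P x (F x) s" "s \<le> p (size x)" "exec Q x (G x) t" "t \<le> q (size x)"
      "exec R x (B x) u" "u \<le> r (size x)"
      using P Q R by meson
    show "\<exists>t. exec (Cond R P Q) x (if B x = Atom then G x else F x) t \<and>
           t \<le> Suc (r (size x) + (p (size x) + q (size x)))"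
    proof (cases "B x")
      case Atom
      thus ?thesis using * by (intro exI[of _ "Suc (u + t)"] conjI) (auto intro: cond_false)
    next
      case (Node a b)
      thus ?thesis using * by (intro exI[of _ "Suc (u + s)"] conjI) (auto intro: cond_true)
    qed
  qed (intro poly_bounded_Suc poly_bounded_intros P Q R)
qed

lemma polynomial_time_if:
  assumes "polynomial_time (\<lambda>x. tbit (B x))" "polynomial_time F" "polynomial_time G"
  shows "polynomial_time (\<lambda>x. if B x then F x else G x)"
  by (rule back_subst[of polynomial_time, OF polynomial_time_if_Atom[OF assms]]) (auto simp: fun_eq_iff)

lemma polynomial_time_eq_Atom:
  assumes "polynomial_time F"
  shows "polynomial_time (\<lambda>x. tbit (F x = Atom))"
  unfolding tbit_def by (intro polynomial_time_if_Atom assms polynomial_time_const)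

lemma polynomial_time_not:
  assumes "polynomial_time (\<lambda>x. tbit (B x))"
  shows "polynomial_time (\<lambda>x. tbit (\<not> B x))"
  using polynomial_time_eq_Atom[OF assms] by simp

lemma polynomial_time_conj:
  assumes "polynomial_time (\<lambda>x. tbit (B x))" "polynomial_time (\<lambda>x. tbit (C x))"
  shows "polynomial_time (\<lambda>x. tbit (B x \<and> C x))"
proof -
  have "polynomial_time (\<lambda>x. if B x then tbit (C x) else Atom)"
    by (intro polynomial_time_if assms polynomial_time_const)
  thus ?thesis by (rule back_subst[of polynomial_time]) (auto simp: fun_eq_iff tbit_def)
qed

lemma polynomial_time_disj:
  assumes "polynomial_time (\<lambda>x. tbit (B x))" "polynomial_time (\<lambda>x. tbit (C x))"
  shows "polynomial_time (\<lambda>x. tbit (B x \<or> C x))"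
  using polynomial_time_not[OF polynomial_time_conj[OF assms[THEN polynomial_time_not]]] by simp

lemma polynomial_time_iff:
  assumes "polynomial_time (\<lambda>x. tbit (B x))" "polynomial_time (\<lambda>x. tbit (C x))"
  shows "polynomial_time (\<lambda>x. tbit (B x \<longleftrightarrow> C x))"
  unfolding iff_conv_conj_imp imp_conv_disj
  by (intro polynomial_time_conj polynomial_time_disj polynomial_time_not assms)

text \<open>The state is remaining list, environment, accumulator, so the test \<open>Hd\<close>
  returns the remaining list and fails exactly when it is exhausted. The accumulator is bounded
  after every prefix of the list, because each round pays for its current size.\<close>

lemma exec_while_fold:
  assumes P: "\<And>L x acc. \<exists>t. exec P (Node L (Node x acc)) (Node (ttl L) (Node x (s x (thd L) acc))) t
      \<and> t \<le> p (size (Node L (Node x acc)))"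
    and "mono p"
    and B: "\<forall>ys zs. dec L = ys @ zs \<longrightarrow> size (fold (s x) ys acc) \<le> B"
  shows "\<exists>t. exec (While Hd P) (Node L (Node x acc)) (Node Atom (Node x (fold (s x) (dec L) acc))) t
      \<and> t \<le> Suc (length (dec L)) * (p (size L + size x + B + 2) + 2 * (size L + size x + B) + 8)"
  using B
proof (induction L arbitrary: acc rule: dec.induct)
  case (1 acc)
  have "size acc \<le> B" using 1[rule_format, of "[]"] by simp
  moreover have "exec (While Hd P) (Node Atom (Node x acc)) (Node Atom (Node x acc))
      (Suc (Suc (size (Node Atom (Node x acc))) + size (Node Atom (Node x acc))))"
    using hd_node[of Atom "Node x acc"] by (rule while_stop)
  ultimately show ?case by (intro exI conjI) auto
next
  case (2 a L acc)
  let ?z = "Node (Node a L) (Node x acc)"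
  have acc: "size acc \<le> B" using 2(2)[rule_format, of "[]"] by simp
  obtain t where t: "exec P ?z (Node L (Node x (s x a acc))) t" "t \<le> p (size ?z)"
    using P[of "Node a L" x acc] by auto
  have "size (fold (s x) ys (s x a acc)) \<le> B" if "dec L = ys @ zs" for ys zs
    using 2(2)[rule_format, of "a # ys" zs] that by simp
  hence "\<forall>ys zs. dec L = ys @ zs \<longrightarrow> size (fold (s x) ys (s x a acc)) \<le> B" by blast
  from 2(1)[OF this] obtain r where r:
    "exec (While Hd P) (Node L (Node x (s x a acc)))
        (Node Atom (Node x (fold (s x) (dec L) (s x a acc)))) r"
    "r \<le> Suc (length (dec L)) * (p (size L + size x + B + 2) + 2 * (size L + size x + B) + 8)"
    by blast
  have "r \<le> Suc (length (dec L)) * (p (size (Node a L) + size x + B + 2) + 2 * (size (Node a L) + size x + B) + 8)"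
    using r(2) by (rule order_trans) (intro mult_left_mono add_mono monoD[OF \<open>mono p\<close>], auto)
  moreover have "t \<le> p (size (Node a L) + size x + B + 2)"
    using t(2) by (rule order_trans) (intro monoD[OF \<open>mono p\<close>], use acc in auto)
  moreover have "exec (While Hd P) ?z (Node Atom (Node x (fold (s x) (dec L) (s x a acc))))
      (Suc (Suc (size ?z) + t + r))"
    using while_step[OF hd_node t(1) r(1)] .
  ultimately show ?case using acc by (intro exI conjI) auto
qed

lemma size_fold_le:
  fixes acc :: tree
  assumes "\<And>a acc. a \<in> set ys \<Longrightarrow> size (f a acc) \<le> size acc + K"
  shows "size (fold f ys acc) \<le> size acc + length ys * K"
  using assms
proof (induction ys arbitrary: acc)
  case (Cons y ys)
  have "size (fold f ys (f y acc)) \<le> size (f y acc) + length ys * K" using Cons by auto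
  moreover have "size (f y acc) \<le> size acc + K" using Cons.prems by simp
  ultimately show ?case by simp
qed simp

text \<open>A step that doubled the accumulator would make the loop exponential. Hence the growth
  per step must be additive, with an increment that depends on environment and list element but not
  on the accumulator; all loops below are shaped to meet this.\<close>

lemma polynomial_time_fold:
  assumes b: "\<And>x a acc. size (s x a acc) \<le> size acc + b (size x + size a)"
    and pb: "poly_bounded b"
    and s: "polynomial_time (\<lambda>z. s (thd z) (thd (ttl z)) (ttl (ttl z)))"
    and L: "polynomial_time L" and I: "polynomial_time I"
  shows "polynomial_time (\<lambda>x. fold (s x) (dec (L x)) (I x))"
proof -
  obtain e where e: "\<And>n. b n \<le> (n + 2) ^ e" using pb unfolding poly_bounded_def by blast
  obtain l where l: "\<And>x. size (L x) \<le> l (size x)" "poly_bounded l" "mono l"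
    using polynomial_time_size[OF L] by blast
  obtain i where i: "\<And>x. size (I x) \<le> i (size x)" "poly_bounded i" "mono i"
    using polynomial_time_size[OF I] by blast
  have "polynomial_time (\<lambda>z. Node (ttl (thd z)) (Node (thd (ttl z)) (s (thd (ttl z)) (thd (thd z)) (ttl (ttl z)))))"
    by (intro polynomial_time_Node polynomial_time_thd polynomial_time_ttl polynomial_time_id
      polynomial_time_comp[OF s, of "\<lambda>z. Node (thd (ttl z)) (Node (thd (thd z)) (ttl (ttl z)))", simplified])
  then obtain P p where P: "\<And>z. \<exists>t. exec P z (Node (ttl (thd z)) (Node (thd (ttl z)) (s (thd (ttl z)) (thd (thd z)) (ttl (ttl z))))) t
     \<and> t \<le> p (size z)" and p: "poly_bounded p" "mono p"
    by (elim polynomial_timeE) blast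
  have P': "\<exists>t. exec P (Node L (Node x acc)) (Node (ttl L) (Node x (s x (thd L) acc))) t
      \<and> t \<le> p (size (Node L (Node x acc)))" for L x acc
    using P[of "Node L (Node x acc)"] by simp
  \<comment> \<open>Initial accumulator plus one increment per list element; both the length of the
    list and the size of its elements are at most \<open>l n\<close>.\<close>
  define B where "B n = i n + l n * (n + l n + 2) ^ e" for n
  have B: "size (fold (s x) ys (I x)) \<le> B (size x)" if zs: "dec (L x) = ys @ zs" for ys zs x
  proof -
    have len: "length ys \<le> l (size x)"
      using length_dec_le[of "L x"] l(1)[of x] zs by simp
    have "size (s x a acc) \<le> size acc + (size x + l (size x) + 2) ^ e" if "a \<in> set ys" for a acc
    proof -
      have "size a \<le> l (size x)"
        using size_in_dec[of a "L x"] that zs l(1)[of x] by simp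
      hence "(size x + size a + 2) ^ e \<le> (size x + l (size x) + 2) ^ e" by (intro power_mono) auto
      with b[of x a acc] e[of "size x + size a"] show ?thesis by linarith
    qed
    from size_fold_le[of ys "s x", OF this]
    have "size (fold (s x) ys (I x)) \<le> size (I x) + length ys * (size x + l (size x) + 2) ^ e" .
    also have "\<dots> \<le> B (size x)"
      unfolding B_def using i(1) len by (intro add_mono mult_right_mono) auto
    finally show ?thesis .
  qed
  have pbB: "poly_bounded B" unfolding B_def by (intro poly_bounded_intros i l)
  define q where "q n = Suc (l n) * (p (l n + n + B n + 2) + 2 * (l n + n + B n) + 8)" for n
  have pq: "poly_bounded q"
    unfolding q_def by (intro poly_bounded_Suc poly_bounded_intros poly_bounded_comp[OF p(1)] p l pbB)
  have "polynomial_time (\<lambda>x. Node (L x) (Node x (I x)))"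
    by (intro polynomial_time_Node L I polynomial_time_id)
  then obtain Q r where Q: "\<And>x. \<exists>t. exec Q x (Node (L x) (Node x (I x))) t \<and> t \<le> r (size x)" "poly_bounded r"
    by (elim polynomial_timeE) blast
  have "polynomial_time (\<lambda>x. Node Atom (Node x (fold (s x) (dec (L x)) (I x))))"
  proof (rule polynomial_timeI[where P = "Seq Q (While Hd P)" and q = "\<lambda>n. Suc (r n + q n)"])
    fix x
    obtain t where t: "exec Q x (Node (L x) (Node x (I x))) t" "t \<le> r (size x)"
      using Q by blast
    obtain u where u: "exec (While Hd P) (Node (L x) (Node x (I x))) (Node Atom (Node x (fold (s x) (dec (L x)) (I x)))) u"
      "u \<le> Suc (length (dec (L x))) * (p (size (L x) + size x + B (size x) + 2) + 2 * (size (L x) + size x + B (size x)) + 8)"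
      using exec_while_fold[where s = s, OF P' p(2), of "L x" x "I x" "B (size x)"] B by auto
    have "u \<le> q (size x)"
      using u(2) unfolding q_def 
      by (rule order_trans) (intro mult_mono add_mono monoD[OF p(2)], use l(1)[of x] length_dec_le[of "L x"] in auto)
    thus "\<exists>t. exec (Seq Q (While Hd P)) x (Node Atom (Node x (fold (s x) (dec (L x)) (I x)))) t
        \<and> t \<le> Suc (r (size x) + q (size x))"
      using seq[OF t(1) u(1)] t(2) by (intro exI conjI) auto
  qed (intro poly_bounded_Suc poly_bounded_intros Q pq)
  from polynomial_time_ttl[OF polynomial_time_ttl[OF this]] show ?thesis by simp
qed

lemma size_thd_ttl: "size (thd t) + size (ttl t) \<le> size t"
  by (cases t) auto

lemma fold_ignore: "fold (\<lambda>_. f) xs = f ^^ length xs"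
  by (induction xs) (auto simp: funpow_Suc_right simp del: funpow.simps)

lemmas polynomial_time_basic =
  polynomial_time_id polynomial_time_const polynomial_time_Node polynomial_time_thd
  polynomial_time_ttl polynomial_time_if polynomial_time_eq_Atom polynomial_time_not
  polynomial_time_conj polynomial_time_disj polynomial_time_iff

lemma polynomial_time_comp2:
  assumes "polynomial_time (\<lambda>z. f (thd z) (ttl z))" "polynomial_time F" "polynomial_time G"
  shows "polynomial_time (\<lambda>x. f (F x) (G x))"
  using polynomial_time_comp[OF assms(1) polynomial_time_Node[OF assms(2,3)]] by simp

lemma polynomial_time_comp3:
  assumes "polynomial_time (\<lambda>z. f (thd z) (thd (ttl z)) (ttl (ttl z)))"
    and "polynomial_time F" "polynomial_time G" "polynomial_time H"
  shows "polynomial_time (\<lambda>x. f (F x) (G x) (H x))"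
  using polynomial_time_comp[OF assms(1) polynomial_time_Node[OF assms(2) polynomial_time_Node[OF assms(3,4)]]]
  by simp

lemma poly_bounded_linear: "poly_bounded (\<lambda>n. a * n + b)"
  by (intro poly_bounded_intros)

subsection \<open>Unary arithmetic\<close>

text \<open>A unary number is the length of a tree read as a list, whatever its elements are.\<close>

definition trev_append :: "tree \<Rightarrow> tree \<Rightarrow> tree" where
  "trev_append a b = fold Node (dec a) b"

definition tdrop :: "tree \<Rightarrow> tree \<Rightarrow> tree" where
  "tdrop a b = fold (\<lambda>_. ttl) (dec a) b"

definition tle :: "tree \<Rightarrow> tree \<Rightarrow> bool" where
  "tle a b \<longleftrightarrow> tdrop b a = Atom"

definition teq :: "tree \<Rightarrow> tree \<Rightarrow> bool" where
  "teq a b \<longleftrightarrow> tle a b \<and> tle b a"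

definition tmult :: "tree \<Rightarrow> tree \<Rightarrow> tree" where
  "tmult a b = fold (\<lambda>_. trev_append a) (dec b) Atom"

lemma dec_trev_append [simp]: "dec (trev_append a b) = rev (dec a) @ dec b"
proof -
  have "dec (fold Node xs b) = rev xs @ dec b" for xs :: "tree list"
    by (induction xs arbitrary: b) auto
  thus ?thesis by (simp add: trev_append_def)
qed

lemma size_trev_append [simp]: "size (trev_append a b) = size a + size b"
proof -
  have "size (fold Node (dec a) b) = size a + size b"
    by (induction a arbitrary: b rule: dec.induct) auto
  thus ?thesis by (simp add: trev_append_def)
qed

lemma dec_ttl [simp]: "dec (ttl t) = tl (dec t)"
  by (cases t) auto

lemma dec_tdrop [simp]: "dec (tdrop a b) = drop (length (dec a)) (dec b)"
proof -
  have "dec (fold (\<lambda>_. ttl) xs b) = drop (length xs) (dec b)" for xs :: "tree list"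
    by (induction xs arbitrary: b) (auto simp: drop_Suc)
  thus ?thesis by (simp add: tdrop_def)
qed

lemma size_tdrop_le: "size (tdrop a b) \<le> size b"
proof -
  have "size (fold (\<lambda>_. ttl) xs b) \<le> size b" for xs :: "tree list"
    by (induction xs arbitrary: b) (auto intro: order_trans[OF _ size_ttl_le])
  thus ?thesis by (simp add: tdrop_def)
qed

lemma tle_iff: "tle a b \<longleftrightarrow> length (dec a) \<le> length (dec b)"
  unfolding tle_def using dec_eq_Nil[of "tdrop b a"] by simp

lemma teq_iff: "teq a b \<longleftrightarrow> length (dec a) = length (dec b)"
  by (auto simp: teq_def tle_iff)

lemma length_tmult [simp]: "length (dec (tmult a b)) = length (dec a) * length (dec b)"
proof -
  have "length (dec (fold (\<lambda>_. trev_append a) xs acc)) = length (dec acc) + length (dec a) * length xs"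
    for xs :: "tree list" and acc
    by (induction xs arbitrary: acc) auto
  thus ?thesis by (simp add: tmult_def)
qed

lemma dec_enc_nat [simp]: "dec (enc_nat n) = replicate n Atom"
  by (simp add: enc_nat_def)

text \<open>Arithmetic only looks at lengths, but encodings demand the literal tree
  \<open>enc_nat n\<close>. Knowing the elements of a product allows it to be identified with such a
  tree.\<close>

lemma set_tmult: "set (dec (tmult a b)) \<subseteq> set (dec a)"
proof -
  have "set (dec (fold (\<lambda>_. trev_append a) xs acc)) \<subseteq> set (dec a) \<union> set (dec acc)" for xs :: "tree list" and acc
  proof (induction xs arbitrary: acc)
    case (Cons x xs)
    show ?case using Cons.IH[of "trev_append a acc"] by auto
  qed simp
  from this[of "dec b" Atom] show ?thesis by (simp add: tmult_def)
qed

lemma set_replicate_subset: "set (replicate n x) \<subseteq> {x}"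
  by (induction n) auto

lemma enc_nat_eqI: "set (dec t) \<subseteq> {Atom} \<Longrightarrow> t = enc_nat (length (dec t))"
  by (metis enc_list_dec enc_nat_def replicate_length_same singletonD subsetD)

lemma polynomial_time_trev_append:
  assumes "polynomial_time F" "polynomial_time G"
  shows "polynomial_time (\<lambda>x. trev_append (F x) (G x))"
proof -
  have "polynomial_time (\<lambda>z. trev_append (thd z) (ttl z))"
    unfolding trev_append_def
    by (rule polynomial_time_fold[where b = "\<lambda>n. 1 * n + 1"]; (intro polynomial_time_basic poly_bounded_linear)?; auto)
  thus ?thesis using assms by (rule polynomial_time_comp2)
qed

lemma polynomial_time_tdrop:
  assumes "polynomial_time F" "polynomial_time G"
  shows "polynomial_time (\<lambda>x. tdrop (F x) (G x))"
proof -
  have "polynomial_time (\<lambda>z. tdrop (thd z) (ttl z))"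
    unfolding tdrop_def
    by (rule polynomial_time_fold[where b = "\<lambda>n. 1 * n + 1"]; (intro polynomial_time_basic poly_bounded_linear)?; auto intro: le_SucI trans_le_add1 size_ttl_le)
  thus ?thesis using assms by (rule polynomial_time_comp2)
qed

lemma polynomial_time_tle:
  "polynomial_time F \<Longrightarrow> polynomial_time G \<Longrightarrow> polynomial_time (\<lambda>x. tbit (tle (F x) (G x)))"
  unfolding tle_def by (intro polynomial_time_basic polynomial_time_tdrop)

lemma polynomial_time_teq:
  "polynomial_time F \<Longrightarrow> polynomial_time G \<Longrightarrow> polynomial_time (\<lambda>x. tbit (teq (F x) (G x)))"
  unfolding teq_def by (intro polynomial_time_basic polynomial_time_tle)

lemma polynomial_time_tmult:
  assumes "polynomial_time F" "polynomial_time G"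
  shows "polynomial_time (\<lambda>x. tmult (F x) (G x))"
proof -
  have "polynomial_time (\<lambda>z. tmult (thd z) (ttl z))"
    unfolding tmult_def
    by (rule polynomial_time_fold[where b = "\<lambda>n. 1 * n + 1"]; (intro polynomial_time_basic polynomial_time_trev_append poly_bounded_linear)?; auto intro: trans_le_add1 le_SucI size_thd_le)
  thus ?thesis using assms by (rule polynomial_time_comp2)
qed

lemmas polynomial_time_unary =
  polynomial_time_basic polynomial_time_trev_append polynomial_time_tdrop polynomial_time_tle
  polynomial_time_teq polynomial_time_tmult

subsection \<open>Binary arithmetic on trees\<close>

primrec val :: "tree \<Rightarrow> nat" where
  "val Atom = 0"
| "val (Node a b) = of_bool (a \<noteq> Atom) + 2 * val b"

abbreviation bits_val :: "bool list \<Rightarrow> nat" where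
  "bits_val \<equiv> horner_sum of_bool 2"

text \<open>This also holds for \<open>Atom\<close>, whose head and tail are \<open>Atom\<close>
  again: a number is implicitly padded with zero bits, so loops may run for a fixed word
  length.\<close>

lemma val_eq: "val t = of_bool (thd t \<noteq> Atom) + 2 * val (ttl t)"
  by (cases t) auto

lemma val_enc_bits: "val (enc_bits bs) = bits_val bs"
  unfolding enc_bits_def by (induction bs) auto

lemma val_less: "val t < 2 ^ length (dec t)"
  by (induction t rule: dec.induct) auto

lemma val_enc_bits_mod: "val (enc_bits bs) mod 2 ^ n = bits_val (take n bs)"
  unfolding val_enc_bits
proof (induction bs arbitrary: n)
  case (Cons b bs n)
  show ?case by (cases n) (auto simp: mod_mult2_eq Cons.IH)
qed simp

text \<open>A ripple-carry adder: the state holds the carry, the unread parts of both summands and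
  the output bits. The booleans \<open>p\<close> and \<open>q\<close> say that the current bits are
  0.\<close>

definition add_step :: "tree \<Rightarrow> tree" where
  "add_step st =
    (let c = thd st; x = thd (ttl st); y = thd (ttl (ttl st)); out = ttl (ttl (ttl st));
         p = (thd x = Atom); q = (thd y = Atom)
     in Node (tbit (\<not> p \<and> \<not> q \<or> c \<noteq> Atom \<and> (\<not> p \<or> \<not> q)))
         (Node (ttl x) (Node (ttl y) (Node (tbit (c = Atom \<longleftrightarrow> (p \<longleftrightarrow> \<not> q))) out))))"

text \<open>Bits accumulate most significant first; reading them back in this way removes leading zeros
  and restores the least significant bit to the front.\<close>

definition canon :: "tree \<Rightarrow> tree" where
  "canon t = fold (\<lambda>b acc. if b = Atom \<and> acc = Atom then Atom else Node b acc) (dec t) Atom"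

definition tadd :: "tree \<Rightarrow> tree \<Rightarrow> tree \<Rightarrow> tree" where
  "tadd w x y =
     canon (ttl (ttl (ttl (fold (\<lambda>_. add_step) (dec w) (Node Atom (Node x (Node y Atom)))))))"

text \<open>No leading zeros. For the total weight this makes the number of bits per draw minimal,
  which keeps the rejection probability at most 1/2.\<close>

definition canonical :: "tree \<Rightarrow> bool" where
  "canonical t \<longleftrightarrow> t = Atom \<or> 2 ^ (length (dec t) - 1) \<le> val t"

text \<open>A model of the adder loop on boolean lists, least significant bit first, separating the
  arithmetic from the tree layout.\<close>

fun add_bits :: "nat \<Rightarrow> bool \<Rightarrow> tree \<Rightarrow> tree \<Rightarrow> bool list" where
  "add_bits 0 c x y = []"
| "add_bits (Suc n) c x y =
    (let p = (thd x = Atom); q = (thd y = Atom)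
     in (\<not> c \<longleftrightarrow> (p \<longleftrightarrow> \<not> q)) #
        add_bits n (\<not> p \<and> \<not> q \<or> c \<and> (\<not> p \<or> \<not> q)) (ttl x) (ttl y))"

lemma mod_2_power_Suc: "(of_bool a + 2 * v) mod 2 ^ Suc n = of_bool a + 2 * (v mod 2 ^ n)"
  for v :: nat
  by (cases a) (simp_all add: mod_mult2_eq)

lemma bits_val_add_bits:
  "bits_val (add_bits n c x y) = (val x + val y + of_bool c) mod 2 ^ n"
proof (induction n arbitrary: c x y)
  case (Suc n)
  define p q where "p = (thd x \<noteq> Atom)" and "q = (thd y \<noteq> Atom)"
  define b where "b = (p \<noteq> (q \<noteq> c))"
  define c' where "c' = (p \<and> q \<or> c \<and> (p \<or> q))"
  have "val x + val y + of_bool c =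
     of_bool b + 2 * (val (ttl x) + val (ttl y) + of_bool c')"
    by (subst (1 2) val_eq) (auto simp: b_def c'_def p_def q_def)
  moreover have "add_bits (Suc n) c x y = b # add_bits n c' (ttl x) (ttl y)"
    by (auto simp: Let_def b_def c'_def p_def q_def)
  ultimately show ?case by (simp only: horner_sum_simps Suc mod_2_power_Suc)
qed simp

lemma dec_add_step:
  "dec (ttl (ttl (ttl ((add_step ^^ n) (Node (tbit c) (Node x (Node y out))))))) =
    rev (map tbit (add_bits n c x y)) @ dec out"
proof (induction n arbitrary: c x y out)
  case (Suc n)
  show ?case
    by (simp only: funpow_Suc_right o_apply)
       (simp add: add_step_def Let_def Suc del: funpow.simps dec_ttl)
qed simp

text \<open>In the reversed list the least significant bit is processed last, so induction on
  \<open>bs\<close> peels off the final step; putting a bit in front of a nonzero canonical number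
  keeps its leading bit.\<close>

lemma canon_spec:
  "val (fold (\<lambda>b acc. if b = Atom \<and> acc = Atom then Atom else Node b acc)
     (rev (map tbit bs)) Atom) = bits_val bs \<and>
   canonical (fold (\<lambda>b acc. if b = Atom \<and> acc = Atom then Atom else Node b acc)
     (rev (map tbit bs)) Atom)"
proof (induction bs)
  case (Cons b bs)
  define t where "t = fold (\<lambda>b acc. if b = Atom \<and> acc = Atom then Atom else Node b acc)
     (rev (map tbit bs)) Atom"
  have "canonical (Node (tbit b) t)" if "b \<or> t \<noteq> Atom"
  proof (cases t)
    case (Node x y)
    hence "2 ^ length (dec y) \<le> val t" using Cons by (auto simp: t_def canonical_def)
    thus ?thesis using Node by (simp add: canonical_def)
  qed (use that in \<open>simp add: canonical_def\<close>)
  thus ?case using Cons by (auto simp: t_def[symmetric] canonical_def)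
qed (simp add: canonical_def)

lemma tadd_spec:
  shows val_tadd: "val (tadd w x y) = (val x + val y) mod 2 ^ length (dec w)"
    and canonical_tadd: "canonical (tadd w x y)"
proof -
  have "dec (ttl (ttl (ttl (fold (\<lambda>_. add_step) (dec w) (Node Atom (Node x (Node y Atom))))))) =
     rev (map tbit (add_bits (length (dec w)) False x y))"
    using dec_add_step[of "length (dec w)" False x y Atom]
    by (simp add: fold_ignore tbit_def del: dec_ttl)
  thus "val (tadd w x y) = (val x + val y) mod 2 ^ length (dec w)" "canonical (tadd w x y)"
    using canon_spec[of "add_bits (length (dec w)) False x y"]
    by (simp_all add: tadd_def canon_def bits_val_add_bits del: dec_ttl)
qed

lemma size_canon_le: "size (canon t) \<le> size t"
proof -
  have "size (fold (\<lambda>b acc. if b = Atom \<and> acc = Atom then Atom else Node b acc) (dec t) acc) \<le> size acc + size t" for acc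
  proof (induction t arbitrary: acc rule: dec.induct)
    case (2 a b acc)
    show ?case using 2[of "if a = Atom \<and> acc = Atom then Atom else Node a acc"] by (auto split: if_splits)
  qed simp
  from this[of Atom] show ?thesis by (simp add: canon_def)
qed

lemma size_add_step_out: "size (ttl (ttl (ttl ((add_step ^^ n) st)))) \<le> size (ttl (ttl (ttl st))) + 2 * n"
proof (induction n)
  case (Suc n)
  have "size (ttl (ttl (ttl (add_step s)))) \<le> size (ttl (ttl (ttl s))) + 2" for s
    using size_tbit_le by (auto simp: add_step_def Let_def intro: le_SucI)
  from this[of "(add_step ^^ n) st"] Suc show ?case by simp
qed simp

lemma size_tadd_le: "size (tadd w x y) \<le> 2 * length (dec w)"
  unfolding tadd_def
  by (rule order_trans[OF size_canon_le])
     (use size_add_step_out[of "length (dec w)" "Node Atom (Node x (Node y Atom))"]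
      in \<open>simp add: fold_ignore\<close>)

lemma polynomial_time_canon:
  assumes "polynomial_time F"
  shows "polynomial_time (\<lambda>x. canon (F x))"
proof -
  have "polynomial_time canon"
    unfolding canon_def
    by (rule polynomial_time_fold[where b = "\<lambda>n. 1 * n + 1"]; (intro polynomial_time_basic poly_bounded_linear)?; auto)
  thus ?thesis using assms by (rule polynomial_time_comp)
qed

lemma size_add_step: "size (add_step st) \<le> size st + 6"
proof -
  have "size (thd (ttl st)) + size (thd (ttl (ttl st))) + size (ttl (ttl (ttl st))) \<le> size st"
    using size_thd_ttl[of st] size_thd_ttl[of "ttl st"] size_thd_ttl[of "ttl (ttl st)"] by linarith
  moreover have "size (ttl (thd (ttl st))) \<le> size (thd (ttl st))"
      "size (ttl (thd (ttl (ttl st)))) \<le> size (thd (ttl (ttl st)))"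
    by (rule size_ttl_le)+
  moreover have "size (add_step st) \<le> size (ttl (thd (ttl st))) + size (ttl (thd (ttl (ttl st)))) + size (ttl (ttl (ttl st))) + 6"
    by (auto simp: add_step_def Let_def tbit_def)
  ultimately show ?thesis by linarith
qed

lemma polynomial_time_tadd:
  assumes "polynomial_time F" "polynomial_time G" "polynomial_time H"
  shows "polynomial_time (\<lambda>x. tadd (F x) (G x) (H x))"
proof -
  have "polynomial_time (\<lambda>z. fold (\<lambda>_. add_step) (dec (thd z))
      (Node Atom (Node (thd (ttl z)) (Node (ttl (ttl z)) Atom))))"
  proof (rule polynomial_time_fold[where b = "\<lambda>n. 0 * n + 6"])
    show "polynomial_time (\<lambda>z. add_step (ttl (ttl z)))"
      unfolding add_step_def Let_def by (intro polynomial_time_basic)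
  qed ((intro polynomial_time_basic poly_bounded_linear)?; use size_add_step in simp)+
  hence "polynomial_time (\<lambda>z. tadd (thd z) (thd (ttl z)) (ttl (ttl z)))"
    unfolding tadd_def by (intro polynomial_time_canon polynomial_time_ttl)
  thus ?thesis using assms by (rule polynomial_time_comp3)
qed

section \<open>Comparison of binary numbers\<close>

definition less_step :: "tree \<Rightarrow> tree" where
  "less_step st =
    (let x = thd (ttl st); y = ttl (ttl st)
     in Node (if thd x = Atom \<longleftrightarrow> thd y = Atom then thd st else tbit (thd y \<noteq> Atom))
          (Node (ttl x) (ttl y)))"

definition tless :: "tree \<Rightarrow> tree \<Rightarrow> tree \<Rightarrow> bool" where
  "tless w x y \<longleftrightarrow> thd (fold (\<lambda>_. less_step) (dec w) (Node Atom (Node x y))) \<noteq> Atom"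

text \<open>Bits are read from the least significant end, so a later difference overrides the
  verdict so far, which starts as false. Only the first \<open>length (dec w)\<close> bits matter;
  hence the whole remaining random tape can be passed as \<open>x\<close> without cutting out the
  current block.\<close>

lemma tless_iff: "tless w x y \<longleftrightarrow> val x mod 2 ^ length (dec w) < val y mod 2 ^ length (dec w)"
proof -
  have "thd ((less_step ^^ n) (Node l (Node x y))) \<noteq> Atom \<longleftrightarrow>
     val x mod 2 ^ n < val y mod 2 ^ n \<or> val x mod 2 ^ n = val y mod 2 ^ n \<and> l \<noteq> Atom" for l n
  proof (induction n arbitrary: l x y)
    case (Suc n)
    define l' where "l' = (if thd x = Atom \<longleftrightarrow> thd y = Atom then l else tbit (thd y \<noteq> Atom))"
    have "(less_step ^^ Suc n) (Node l (Node x y)) = (less_step ^^ n) (Node l' (Node (ttl x) (ttl y)))"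
      by (simp add: funpow_Suc_right less_step_def Let_def l'_def del: funpow.simps)
    moreover have "val x mod 2 ^ Suc n = of_bool (thd x \<noteq> Atom) + 2 * (val (ttl x) mod 2 ^ n)"
      by (subst val_eq) (rule mod_2_power_Suc)
    moreover have "val y mod 2 ^ Suc n = of_bool (thd y \<noteq> Atom) + 2 * (val (ttl y) mod 2 ^ n)"
      by (subst val_eq) (rule mod_2_power_Suc)
    ultimately show ?case
      by (simp only: Suc) (auto simp: l'_def split: if_splits)
  qed simp
  thus ?thesis by (simp add: tless_def fold_ignore)
qed

lemma size_less_step: "size (less_step st) \<le> size st + 3"
proof -
  have "size (thd st) + size (thd (ttl st)) + size (ttl (ttl st)) \<le> size st"
    using size_thd_ttl[of st] size_thd_ttl[of "ttl st"] by linarith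
  moreover have "size (ttl (thd (ttl st))) \<le> size (thd (ttl st))"
      "size (ttl (ttl (ttl st))) \<le> size (ttl (ttl st))"
    by (rule size_ttl_le)+
  moreover have "size (less_step st) \<le> size (thd st) + size (ttl (thd (ttl st))) + size (ttl (ttl (ttl st))) + 3"
    by (auto simp: less_step_def Let_def tbit_def)
  ultimately show ?thesis by linarith
qed

lemma polynomial_time_tless:
  assumes "polynomial_time F" "polynomial_time G" "polynomial_time H"
  shows "polynomial_time (\<lambda>x. tbit (tless (F x) (G x) (H x)))"
proof -
  have "polynomial_time (\<lambda>z. fold (\<lambda>_. less_step) (dec (thd z)) (Node Atom (Node (thd (ttl z)) (ttl (ttl z)))))"
  proof (rule polynomial_time_fold[where b = "\<lambda>n. 0 * n + 3"])
    show "polynomial_time (\<lambda>z. less_step (ttl (ttl z)))"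
      unfolding less_step_def Let_def by (intro polynomial_time_basic)
  qed ((intro polynomial_time_basic poly_bounded_linear)?; use size_less_step in simp)+
  hence "polynomial_time (\<lambda>z. tbit (tless (thd z) (thd (ttl z)) (ttl (ttl z))))"
    unfolding tless_def by (intro polynomial_time_basic)
  thus ?thesis using assms by (rule polynomial_time_comp3)
qed

subsection \<open>The reduction as a tree program\<close>

lemmas polynomial_time_arith = polynomial_time_unary polynomial_time_tadd polynomial_time_tless

lemma dec_fold_Node_if:
  "dec (fold (\<lambda>e acc. if P e then Node (f e) acc else acc) xs acc) = rev (map f (filter P xs)) @ dec acc"
  by (induction xs arbitrary: acc) auto

text \<open>The list comes out in reverse order with the total weight at its head; in the first
  round \<open>thd Atom\<close> serves as the number 0.\<close>

definition prefix_sums :: "tree \<Rightarrow> tree \<Rightarrow> tree" where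
  "prefix_sums w ws = fold (\<lambda>x acc. Node (tadd w (thd acc) x) acc) (dec ws) Atom"

text \<open>The total number of bits of all weights, in unary: a word length at which no prefix sum
  overflows.\<close>

definition width :: "tree \<Rightarrow> tree" where
  "width ws = fold trev_append (dec ws) Atom"

definition rank :: "tree \<Rightarrow> tree \<Rightarrow> tree \<Rightarrow> tree" where
  "rank w r ps = fold (\<lambda>s acc. if \<not> tless w r s then Node Atom acc else acc) (dec ps) Atom"

text \<open>Counts up in binary once per element of \<open>n\<close>. The tree \<open>n\<close> is
  also the word length, which is enough as a number is less than 2 to its own power.\<close>

definition binary :: "tree \<Rightarrow> tree" where
  "binary n = fold (\<lambda>_ acc. tadd n acc (Node (Node Atom Atom) Atom)) (dec n) Atom"

lemma polynomial_time_prefix_sums: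
  assumes "polynomial_time F" "polynomial_time G"
  shows "polynomial_time (\<lambda>x. prefix_sums (F x) (G x))"
proof -
  have "size (tadd (thd z) x y) \<le> 2 * size z" for x y z
    using size_tadd_le[of "thd z" x y] length_dec_le[of "thd z"] size_thd_le[of z] by linarith
  hence "polynomial_time (\<lambda>z. prefix_sums (thd z) (ttl z))"
    unfolding prefix_sums_def
    by (intro polynomial_time_fold[where b = "\<lambda>n. 2 * n + 1"]; (intro polynomial_time_arith poly_bounded_linear)?;
        auto intro: le_SucI trans_le_add1)
  thus ?thesis using assms by (rule polynomial_time_comp2)
qed

lemma polynomial_time_width:
  assumes "polynomial_time F"
  shows "polynomial_time (\<lambda>x. width (F x))"
proof -
  have "polynomial_time width"
    unfolding width_def
    by (rule polynomial_time_fold[where b = "\<lambda>n. 1 * n + 1"]; (intro polynomial_time_arith poly_bounded_linear)?; auto)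
  thus ?thesis using assms by (rule polynomial_time_comp)
qed

lemma polynomial_time_rank:
  assumes "polynomial_time F" "polynomial_time G" "polynomial_time H"
  shows "polynomial_time (\<lambda>x. rank (F x) (G x) (H x))"
proof -
  have "polynomial_time (\<lambda>z. rank (thd z) (thd (ttl z)) (ttl (ttl z)))"
    unfolding rank_def
    by (rule polynomial_time_fold[where b = "\<lambda>n. 1 * n + 1"]; (intro polynomial_time_arith poly_bounded_linear)?; auto)
  thus ?thesis using assms by (rule polynomial_time_comp3)
qed

lemma polynomial_time_binary:
  assumes "polynomial_time F"
  shows "polynomial_time (\<lambda>x. binary (F x))"
proof -
  have "size (tadd z x y) \<le> size x + (2 * (size z + size a) + 0)" for x y z a :: tree
    using size_tadd_le[of z x y] length_dec_le[of z] by simp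
  hence "polynomial_time binary"
    unfolding binary_def
    by (rule polynomial_time_fold[where b = "\<lambda>n. 2 * n + 0"]; intro polynomial_time_arith poly_bounded_linear)
  thus ?thesis using assms by (rule polynomial_time_comp)
qed

lemma size_rank_le: "size (rank w r ps) \<le> size ps"
proof -
  have "size (fold (\<lambda>s acc. if \<not> tless w r s then Node Atom acc else acc) xs acc) \<le> size acc + length xs" for xs acc
  proof (induction xs arbitrary: acc)
    case (Cons x xs)
    show ?case using Cons[of acc] Cons[of "Node Atom acc"] by simp
  qed simp
  from this[of "dec ps" Atom] length_dec_le[of ps] show ?thesis by (simp add: rank_def)
qed

text \<open>The state is a pair of the remaining random tape and the samples so far. The rank of the next
  number on the tape is the sampled vertex, or \<open>nl\<close> when the number exceeds the total weight.\<close>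

definition sample_step :: "tree \<Rightarrow> tree \<Rightarrow> tree \<Rightarrow> tree \<Rightarrow> tree \<Rightarrow> tree" where
  "sample_step s ps nl m st =
    (let i = rank s (thd st) ps
     in Node (tdrop s (thd st)) (if tle nl i \<or> tle m (ttl st) then ttl st else Node i (ttl st)))"

text \<open>The argument packs the word length, the prefix sums, the number of left vertices, the
  number of samples wanted, the number of draws and the random tape, in this order.\<close>

definition samples :: "tree \<Rightarrow> tree" where
  "samples z = ttl (fold (\<lambda>_. sample_step (thd z) (thd (ttl z)) (thd (ttl (ttl z))) (thd (ttl (ttl (ttl z)))))
      (dec (thd (ttl (ttl (ttl (ttl z)))))) (Node (ttl (ttl (ttl (ttl (ttl z))))) Atom))"

lemma size_sample_step: "size (sample_step s ps nl m st) \<le> size st + size ps + 2"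
  using size_tdrop_le[of s "thd st"] size_thd_ttl[of st] size_rank_le[of s "thd st" ps]
  by (simp add: sample_step_def Let_def)

lemma polynomial_time_samples:
  assumes "polynomial_time F"
  shows "polynomial_time (\<lambda>x. samples (F x))"
proof -
  have "polynomial_time samples"
    unfolding samples_def
  proof (rule polynomial_time_ttl, rule polynomial_time_fold[where b = "\<lambda>n. 1 * n + 2"])
    fix z a acc :: tree
    have "size (sample_step (thd z) (thd (ttl z)) (thd (ttl (ttl z))) (thd (ttl (ttl (ttl z)))) acc)
      \<le> size acc + size (thd (ttl z)) + 2" by (rule size_sample_step)
    moreover have "size (thd (ttl z)) \<le> size z"
      using size_ttl_le[of z] size_thd_le[of "ttl z"] by linarith
    ultimately show "size (sample_step (thd z) (thd (ttl z)) (thd (ttl (ttl z))) (thd (ttl (ttl (ttl z)))) acc)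
        \<le> size acc + (1 * (size z + size a) + 2)" by simp
  qed ((unfold sample_step_def Let_def)?, intro poly_bounded_linear polynomial_time_arith polynomial_time_rank)+
  thus ?thesis using assms by (rule polynomial_time_comp)
qed

text \<open>Numbering the samples downwards from \<open>m\<close> keeps the size of the numbers bounded by the size of
  the environment.\<close>

definition number :: "tree \<Rightarrow> tree \<Rightarrow> tree" where
  "number m us = fold (\<lambda>u acc. Node (Node (tdrop (Node Atom acc) m) u) acc) (dec us) Atom"

text \<open>The pair \<open>p\<close> consists of the new name of a sample and the vertex sampled; a
  copied edge keeps its right endpoint and its permutation.\<close>

definition edges_of :: "tree \<Rightarrow> tree \<Rightarrow> tree \<Rightarrow> tree" where
  "edges_of es p acc = fold (\<lambda>e acc. if teq (thd e) (ttl p) then Node (Node (thd p) (ttl e)) acc else acc)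
     (dec es) acc"

definition copy_edges :: "tree \<Rightarrow> tree \<Rightarrow> tree" where
  "copy_edges es ps = fold (edges_of es) (dec ps) Atom"

definition degree_at :: "tree \<Rightarrow> tree \<Rightarrow> tree" where
  "degree_at v es = fold (\<lambda>e acc. if teq (thd (ttl e)) v then Node Atom acc else acc) (dec es) Atom"

definition prune :: "tree \<Rightarrow> tree \<Rightarrow> tree" where
  "prune t es = fold (\<lambda>e acc. if tle (degree_at (thd (ttl e)) es) t then Node e acc else acc) (dec es) Atom"

text \<open>Recovers \<open>d\<close>: in a left regular instance vertex 0 has degree
  \<open>d\<close>, and its name is encoded by \<open>Atom\<close>.\<close>

definition degree_zero :: "tree \<Rightarrow> tree" where
  "degree_zero es = fold (\<lambda>e acc. if thd e = Atom then Node Atom acc else acc) (dec es) Atom"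

definition unit_weights :: "tree \<Rightarrow> tree" where
  "unit_weights m = fold (\<lambda>_. Node (Node (Node Atom Atom) Atom)) (dec m) Atom"

lemma polynomial_time_number:
  assumes "polynomial_time F" "polynomial_time G"
  shows "polynomial_time (\<lambda>x. number (F x) (G x))"
proof -
  have *: "size (tdrop t (thd z)) \<le> size z" for t z
    using size_tdrop_le[of t "thd z"] size_thd_le[of z] by linarith
  have "size (Node (Node (tdrop t (thd z)) u) acc) \<le> size acc + (1 * (size z + size u) + 2)" for t z u acc
    using *[of t z] by simp
  hence "polynomial_time (\<lambda>z. number (thd z) (ttl z))"
    unfolding number_def
    by (rule polynomial_time_fold[where b = "\<lambda>n. 1 * n + 2"]; intro polynomial_time_arith poly_bounded_linear)
  thus ?thesis using assms by (rule polynomial_time_comp2)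
qed

text \<open>The inner loop adds an amount independent of its start value, as required for its use as
  the step of the outer loop in \<open>copy_edges\<close>.\<close>

lemma size_edges_of: "size (edges_of es p acc) \<le> size acc + length (dec es) * (size p + size es + 2)"
  unfolding edges_of_def
proof (rule size_fold_le)
  fix e acc assume "e \<in> set (dec es)"
  hence "size (ttl e) \<le> size es"
    using size_in_dec[of e es] size_ttl_le[of e] by linarith
  thus "size (if teq (thd e) (ttl p) then Node (Node (thd p) (ttl e)) acc else acc)
      \<le> size acc + (size p + size es + 2)"
    using size_thd_le[of p] by auto
qed

lemma polynomial_time_edges_of:
  assumes "polynomial_time F" "polynomial_time G" "polynomial_time H"
  shows "polynomial_time (\<lambda>x. edges_of (F x) (G x) (H x))"
proof -
  have "polynomial_time (\<lambda>z. edges_of (thd z) (thd (ttl z)) (ttl (ttl z)))"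
    unfolding edges_of_def
  proof (rule polynomial_time_fold[where b = "\<lambda>n. 1 * n + 2"])
    fix z e acc :: tree
    show "size (if teq (thd e) (ttl (thd (ttl z))) then Node (Node (thd (thd (ttl z))) (ttl e)) acc else acc)
      \<le> size acc + (1 * (size z + size e) + 2)"
      using size_thd_le[of "thd (ttl z)"] size_thd_le[of "ttl z"] size_ttl_le[of z] size_ttl_le[of e] by auto
  qed (intro polynomial_time_arith poly_bounded_linear)+
  thus ?thesis using assms by (rule polynomial_time_comp3)
qed

lemma polynomial_time_copy_edges:
  assumes "polynomial_time F" "polynomial_time G"
  shows "polynomial_time (\<lambda>x. copy_edges (F x) (G x))"
proof -
  have "polynomial_time (\<lambda>z. copy_edges (thd z) (ttl z))"
    unfolding copy_edges_def
  proof (rule polynomial_time_fold[where b = "\<lambda>n. n * (n + 2)"])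
    fix z p acc :: tree
    have "length (dec (thd z)) * (size p + size (thd z) + 2) \<le> (size z + size p) * (size z + size p + 2)"
      using size_thd_le[of z] length_dec_le[of "thd z"] by (intro mult_mono) auto
    with size_edges_of[of "thd z" p acc]
    show "size (edges_of (thd z) p acc) \<le> size acc + (size z + size p) * (size z + size p + 2)"
      by linarith
  qed (intro polynomial_time_arith polynomial_time_edges_of poly_bounded_intros)+
  thus ?thesis using assms by (rule polynomial_time_comp2)
qed

lemma polynomial_time_degree_at:
  assumes "polynomial_time F" "polynomial_time G"
  shows "polynomial_time (\<lambda>x. degree_at (F x) (G x))"
proof -
  have "polynomial_time (\<lambda>z. degree_at (thd z) (ttl z))"
    unfolding degree_at_def
    by (rule polynomial_time_fold[where b = "\<lambda>n. 1 * n + 1"]; (intro polynomial_time_arith poly_bounded_linear)?; auto)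
  thus ?thesis using assms by (rule polynomial_time_comp2)
qed

lemma polynomial_time_prune:
  assumes "polynomial_time F" "polynomial_time G"
  shows "polynomial_time (\<lambda>x. prune (F x) (G x))"
proof -
  have "polynomial_time (\<lambda>z. prune (thd z) (ttl z))"
    unfolding prune_def
    by (rule polynomial_time_fold[where b = "\<lambda>n. 1 * n + 1"];
        (intro polynomial_time_arith polynomial_time_degree_at poly_bounded_linear)?; auto)
  thus ?thesis using assms by (rule polynomial_time_comp2)
qed

lemma polynomial_time_degree_zero:
  assumes "polynomial_time F"
  shows "polynomial_time (\<lambda>x. degree_zero (F x))"
proof -
  have "polynomial_time degree_zero"
    unfolding degree_zero_def
    by (rule polynomial_time_fold[where b = "\<lambda>n. 1 * n + 1"]; (intro polynomial_time_arith poly_bounded_linear)?; auto)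
  thus ?thesis using assms by (rule polynomial_time_comp)
qed

lemma polynomial_time_unit_weights:
  assumes "polynomial_time F"
  shows "polynomial_time (\<lambda>x. unit_weights (F x))"
proof -
  have "polynomial_time unit_weights"
    unfolding unit_weights_def
    by (rule polynomial_time_fold[where b = "\<lambda>n. 1 * n + 3"]; (intro polynomial_time_arith poly_bounded_linear)?; auto)
  thus ?thesis using assms by (rule polynomial_time_comp)
qed

section \<open>Assembling the reduction\<close>

abbreviation "inst_nl x \<equiv> thd x"
abbreviation "inst_nr x \<equiv> thd (ttl x)"
abbreviation "inst_k x \<equiv> thd (ttl (ttl x))"
abbreviation "inst_es x \<equiv> thd (ttl (ttl (ttl x)))"
abbreviation "inst_ws x \<equiv> thd (ttl (ttl (ttl (ttl x))))"

text \<open>The bit length of \<open>k - 1\<close> stands in for the logarithm of \<open>k\<close>.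
  It vanishes for \<open>k = 1\<close>, exactly where the required degree bound vanishes
  too.\<close>

definition rate :: "nat \<Rightarrow> tree \<Rightarrow> tree" where
  "rate c x = tmult (enc_nat c) (binary (ttl (inst_k x)))"

definition sample_count :: "nat \<Rightarrow> tree \<Rightarrow> tree" where
  "sample_count c x = tmult (rate c x) (inst_nr x)"

definition run_samples :: "nat \<Rightarrow> tree \<Rightarrow> tree \<Rightarrow> tree" where
  "run_samples c x r =
    (let ps = prefix_sums (width (inst_ws x)) (inst_ws x)
     in samples (Node (thd ps) (Node ps (Node (inst_nl x) (Node (sample_count c x)
          (Node (tmult (sample_count c x) (enc_nat 8)) r))))))"

definition trivial_output :: "tree \<Rightarrow> tree" where
  "trivial_output x = Node (Node Atom Atom) (Node Atom (Node (inst_k x) (Node Atom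
      (Node (unit_weights (Node Atom Atom)) Atom))))"

definition threshold :: "nat \<Rightarrow> tree \<Rightarrow> tree" where
  "threshold c x = tmult (tmult (rate c x) (degree_zero (inst_es x))) (enc_nat 5)"

definition sampled_output :: "nat \<Rightarrow> tree \<Rightarrow> tree \<Rightarrow> tree" where
  "sampled_output c x us = Node (sample_count c x) (Node (inst_nr x) (Node (inst_k x)
      (Node (prune (threshold c x) (copy_edges (inst_es x) (number (sample_count c x) us)))
      (Node (unit_weights (sample_count c x)) Atom))))"

text \<open>Zero samples are requested when the alphabet has one letter or there are no right
  vertices; this case and a failed rejection loop both fall back to the edgeless output.\<close>

definition reduction :: "nat \<Rightarrow> tree \<Rightarrow> tree \<Rightarrow> tree" where
  "reduction c x r =
    (let us = run_samples c x r
     in if sample_count c x = Atom \<or> \<not> tle (sample_count c x) us then trivial_output x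
        else sampled_output c x us)"

lemma polynomial_time_reduction: "polynomial_time (\<lambda>z. reduction c (thd z) (ttl z))"
  unfolding reduction_def run_samples_def sampled_output_def trivial_output_def threshold_def
    sample_count_def rate_def Let_def
  by (intro polynomial_time_arith polynomial_time_samples polynomial_time_prune
    polynomial_time_copy_edges polynomial_time_number polynomial_time_unit_weights
    polynomial_time_degree_zero polynomial_time_binary polynomial_time_prefix_sums
    polynomial_time_width)

subsection \<open>Exponential moments and rejection sampling\<close>

lemma finite_set_replicate_pmf: "finite (set_pmf p) \<Longrightarrow> finite (set_pmf (replicate_pmf n p))"
  by (auto simp: set_replicate_pmf lists_eq_set intro: finite_subset[OF _ finite_lists_length_eq[of "set_pmf p" n]])

text \<open>Integrates out the first entry. The index set \<open>A\<close> may exceed the support,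
  so that two distributions can be summed over a common set when rejection sampling is
  analysed.\<close>

lemma expectation_replicate_Suc:
  fixes h :: "'a list \<Rightarrow> real"
  assumes "finite A" "set_pmf p \<subseteq> A"
  shows "measure_pmf.expectation (replicate_pmf (Suc n) p) h =
    (\<Sum>a\<in>A. pmf p a * measure_pmf.expectation (replicate_pmf n p) (\<lambda>xs. h (a # xs)))"
proof -
  have fin: "finite (set_pmf p)" using assms finite_subset by blast
  have "replicate_pmf (Suc n) p = p \<bind> (\<lambda>x. map_pmf (Cons x) (replicate_pmf n p))"
    by (simp add: map_pmf_def)
  thus ?thesis
    using assms fin by (simp only:) (subst pmf_expectation_bind[of A], auto simp: finite_set_replicate_pmf)
qed

text \<open>Independence turns the moment into a product: each entry contributes the factor
  \<open>c\<close> if \<open>Q\<close> holds and 1 otherwise.\<close>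

lemma expectation_power_count:
  fixes c :: real
  assumes "finite (set_pmf p)"
  shows "measure_pmf.expectation (replicate_pmf n p) (\<lambda>xs. c ^ length (filter Q xs)) =
    (1 + (c - 1) * measure_pmf.prob p {x. Q x}) ^ n"
proof (induction n)
  case (Suc n)
  have 1: "(\<Sum>a\<in>set_pmf p. pmf p a) = 1"
    using assms by (simp add: sum_pmf_eq_1)
  have "measure_pmf.prob p {x. Q x} = measure_pmf.prob p ({x. Q x} \<inter> set_pmf p)"
    by (simp add: measure_Int_set_pmf)
  also have "\<dots> = (\<Sum>a\<in>{x. Q x} \<inter> set_pmf p. pmf p a)"
    using assms by (intro measure_measure_pmf_finite) auto
  also have "\<dots> = (\<Sum>a\<in>set_pmf p. if Q a then pmf p a else 0)"
    using assms by (simp add: sum.If_cases Int_commute)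
  finally have q: "measure_pmf.prob p {x. Q x} = (\<Sum>a\<in>set_pmf p. if Q a then pmf p a else 0)" .
  have "measure_pmf.expectation (replicate_pmf (Suc n) p) (\<lambda>xs. c ^ length (filter Q xs)) =
     (\<Sum>a\<in>set_pmf p. (pmf p a + (c - 1) * (if Q a then pmf p a else 0)) *
       measure_pmf.expectation (replicate_pmf n p) (\<lambda>xs. c ^ length (filter Q xs)))"
    using assms by (subst expectation_replicate_Suc[of "set_pmf p"]) (auto intro!: sum.cong simp: algebra_simps)
  also have "\<dots> = (1 + (c - 1) * measure_pmf.prob p {x. Q x}) * (1 + (c - 1) * measure_pmf.prob p {x. Q x}) ^ n"
    unfolding Suc by (simp add: q 1 sum.distrib sum_distrib_left[symmetric] flip: sum_distrib_right)
  finally show ?case by simp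
qed simp

text \<open>From \<open>1 + y \<le> exp y\<close>, for bases on both sides of 1; the base of the
  power must be seen to be nonnegative before powers can be compared.\<close>

lemma expectation_power_count_le:
  fixes c :: real
  assumes "finite (set_pmf p)" "0 \<le> c" and q: "(c - 1) * measure_pmf.prob p {x. Q x} \<le> t"
  shows "measure_pmf.expectation (replicate_pmf n p) (\<lambda>xs. c ^ length (filter Q xs)) \<le> exp (t * n)"
proof -
  let ?q = "measure_pmf.prob p {x. Q x}"
  have "(1 - c) * ?q \<le> 1"
  proof (cases "c \<le> 1")
    case True
    thus ?thesis using assms(2) by (intro mult_le_one) auto
  next
    case False
    hence "(1 - c) * ?q \<le> 0" by (intro mult_nonpos_nonneg) auto
    thus ?thesis by simp
  qed
  hence "0 \<le> 1 + (c - 1) * ?q" by (simp add: algebra_simps)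
  moreover have "1 + (c - 1) * ?q \<le> exp t"
    using q exp_ge_add_one_self[of t] by linarith
  ultimately have "(1 + (c - 1) * ?q) ^ n \<le> exp t ^ n" by (intro power_mono)
  thus ?thesis by (simp add: expectation_power_count[OF assms(1)] exp_of_nat2_mult)
qed

text \<open>Markov's inequality, with its hypotheses needed only on the support, where samples are
  known to be lists of vertices of the right length.\<close>

lemma prob_le_expectation_divide:
  fixes h :: "'a \<Rightarrow> real"
  assumes "finite (set_pmf p)" "0 < a" "\<And>x. x \<in> set_pmf p \<Longrightarrow> 0 \<le> h x"
    and "\<And>x. x \<in> set_pmf p \<Longrightarrow> x \<in> S \<Longrightarrow> a \<le> h x"
  shows "measure_pmf.prob p S \<le> measure_pmf.expectation p h / a"
proof -
  have "measure_pmf.prob p S * a = measure_pmf.expectation p (\<lambda>x. indicator S x * a)"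
    by simp
  also have "\<dots> \<le> measure_pmf.expectation p h"
    using assms by (intro integral_mono_AE integrable_measure_pmf_finite)
      (auto simp: AE_measure_pmf_iff indicator_def)
  finally show ?thesis using assms(2) by (simp add: field_simps)
qed

text \<open>Lower tail at half the mean, by the moment of base 1/2. The constant is
  \<open>11/72 = (1 - 25/36) / 2\<close>, with 25/36 an upper bound for \<open>ln 2\<close>.\<close>

lemma prob_count_less:
  assumes "finite (set_pmf p)" and q: "\<gamma> \<le> measure_pmf.prob p {x. Q x}" and "0 \<le> \<gamma>"
  shows "measure_pmf.prob (replicate_pmf n p) {xs. real (length (filter Q xs)) < \<gamma> * n / 2}
    \<le> exp (- (11 / 72) * \<gamma> * n)"
proof -
  let ?a = "exp (- ln 2 * (\<gamma> * n / 2))"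
  have "measure_pmf.prob (replicate_pmf n p) {xs. real (length (filter Q xs)) < \<gamma> * n / 2}
     \<le> measure_pmf.expectation (replicate_pmf n p) (\<lambda>xs. (1 / 2) ^ length (filter Q xs)) / ?a"
  proof (rule prob_le_expectation_divide[OF finite_set_replicate_pmf[OF assms(1)]])
    fix xs assume "xs \<in> {xs. real (length (filter Q xs)) < \<gamma> * n / 2}"
    hence "?a \<le> exp (- ln 2 * real (length (filter Q xs)))" by simp
    also have "\<dots> = (1 / 2) ^ length (filter Q xs)"
      by (simp add: exp_of_nat2_mult exp_minus power_one_over inverse_eq_divide)
    finally show "?a \<le> (1 / 2) ^ length (filter Q xs)" .
  qed auto
  also have "\<dots> \<le> exp (- (\<gamma> / 2) * n) / ?a"
    using q by (intro divide_right_mono expectation_power_count_le assms) auto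
  also have "\<dots> = exp ((ln 2 - 1) * (\<gamma> * n / 2))"
    by (simp add: exp_diff[symmetric] algebra_simps)
  also have "\<dots> \<le> exp ((25 / 36 - 1) * (\<gamma> * n / 2))"
    using ln2_le_25_over_36 \<open>0 \<le> \<gamma>\<close> unfolding exp_le_cancel_iff by (intro mult_right_mono) auto
  finally show ?thesis by (simp add: algebra_simps)
qed

text \<open>Upper tail at four times the mean, by the moment of base 2: the exponent is
  \<open>1 - 4 * ln 2\<close>, below -1 because \<open>ln 2 \<ge> 2/3\<close>. This is the origin of
  the loss from \<epsilon> to 4\<epsilon>.\<close>

lemma prob_count_greater:
  assumes "finite (set_pmf p)" and q: "measure_pmf.prob p {x. Q x} \<le> \<epsilon>" and "0 \<le> \<epsilon>"
  shows "measure_pmf.prob (replicate_pmf n p) {xs. real (length (filter Q xs)) > 4 * \<epsilon> * n}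
    \<le> exp (- \<epsilon> * n)"
proof -
  let ?a = "exp (ln 2 * (4 * \<epsilon> * n))"
  have "measure_pmf.prob (replicate_pmf n p) {xs. real (length (filter Q xs)) > 4 * \<epsilon> * n}
     \<le> measure_pmf.expectation (replicate_pmf n p) (\<lambda>xs. 2 ^ length (filter Q xs)) / ?a"
  proof (rule prob_le_expectation_divide[OF finite_set_replicate_pmf[OF assms(1)]])
    fix xs assume "xs \<in> {xs. real (length (filter Q xs)) > 4 * \<epsilon> * n}"
    hence "?a \<le> exp (ln 2 * real (length (filter Q xs)))" by simp
    also have "\<dots> = 2 ^ length (filter Q xs)"
      by (simp add: exp_of_nat2_mult)
    finally show "?a \<le> 2 ^ length (filter Q xs)" .
  qed auto
  also have "\<dots> \<le> exp (\<epsilon> * n) / ?a"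
    using q by (intro divide_right_mono expectation_power_count_le assms) auto
  also have "\<dots> = exp ((1 - 4 * ln 2) * (\<epsilon> * n))"
    by (simp add: exp_diff[symmetric] algebra_simps)
  also have "\<dots> \<le> exp ((- 1) * (\<epsilon> * n))"
    using ln2_ge_two_thirds \<open>0 \<le> \<epsilon>\<close> unfolding exp_le_cancel_iff by (intro mult_right_mono) auto
  finally show ?thesis by simp
qed

text \<open>On \<open>A\<close> the law \<nu> is proportional to \<mu>, so accepted entries are
  distributed as \<mu>. Counting only runs that collect \<open>m\<close> of them can merely lower
  the probability, hence an inequality. The induction removes one draw: acceptance passes to
  \<open>m - 1\<close> and the tail of the event, rejection leaves \<open>m\<close> and
  \<open>E\<close> as they are.\<close>

lemma prob_rejection:
  assumes fin: "finite (set_pmf \<nu>)" "finite (set_pmf \<mu>)" and sub: "set_pmf \<mu> \<subseteq> A"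
    and eq: "\<And>u. u \<in> A \<Longrightarrow> pmf \<nu> u = r * pmf \<mu> u" and r: "0 \<le> r"
  shows "measure_pmf.prob (replicate_pmf n \<nu>)
      {xs. m \<le> length (filter (\<lambda>u. u \<in> A) xs) \<and> take m (filter (\<lambda>u. u \<in> A) xs) \<in> E}
    \<le> measure_pmf.prob (replicate_pmf m \<mu>) E"
proof (induction n arbitrary: m E)
  case 0
  show ?case by (cases m) (auto simp: measure_return_pmf indicator_def)
next
  case (Suc n)
  define F where "F = set_pmf \<nu> \<union> set_pmf \<mu>"
  have F: "finite F" "set_pmf \<nu> \<subseteq> F" "set_pmf \<mu> \<subseteq> F" using fin by (auto simp: F_def)
  let ?P = "\<lambda>n m E. measure_pmf.prob (replicate_pmf n \<nu>)
      {xs. m \<le> length (filter (\<lambda>u. u \<in> A) xs) \<and> take m (filter (\<lambda>u. u \<in> A) xs) \<in> E}"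
  let ?Q = "\<lambda>m E. measure_pmf.prob (replicate_pmf m \<mu>) E"
  show ?case
  proof (cases m)
    case 0
    show ?thesis
    proof (cases "[] \<in> E")
      case True
      hence "?Q m E = 1" using 0 by (simp add: measure_return_pmf)
      thus ?thesis by simp
    qed (simp add: 0)
  next
    case (Suc m')
    have Q: "?Q m E = (\<Sum>a\<in>F. pmf \<mu> a * ?Q m' {l. a # l \<in> E})"
    proof -
      have "?Q m E = measure_pmf.expectation (replicate_pmf (Suc m') \<mu>) (indicator E)"
        by (simp add: Suc)
      also have "\<dots> = (\<Sum>a\<in>F. pmf \<mu> a * measure_pmf.expectation (replicate_pmf m' \<mu>) (\<lambda>xs. indicator E (a # xs)))"
        by (rule expectation_replicate_Suc[OF F(1,3)])
      also have "(\<lambda>a. \<lambda>xs. indicator E (a # xs) :: real) = (\<lambda>a. indicator {l. a # l \<in> E})"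
        by (auto simp: indicator_def fun_eq_iff)
      finally show ?thesis by (simp add: fun_eq_iff)
    qed
    define S where "S = {xs. m \<le> length (filter (\<lambda>u. u \<in> A) xs) \<and> take m (filter (\<lambda>u. u \<in> A) xs) \<in> E}"
    have "?P (Suc n) m E = measure_pmf.expectation (replicate_pmf (Suc n) \<nu>) (indicator S)"
      by (simp add: S_def)
    also have "\<dots> = (\<Sum>a\<in>F. pmf \<nu> a * measure_pmf.expectation (replicate_pmf n \<nu>) (\<lambda>xs. indicator S (a # xs)))"
      by (rule expectation_replicate_Suc[OF F(1,2)])
    also have "\<dots> = (\<Sum>a\<in>F. pmf \<nu> a * (if a \<in> A then ?P n m' {l. a # l \<in> E} else ?P n m E))"
    proof (intro sum.cong refl, goal_cases)
      case (1 a)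
      have "(\<lambda>xs. indicator S (a # xs) :: real) = indicator (if a \<in> A then
          {xs. m' \<le> length (filter (\<lambda>u. u \<in> A) xs) \<and> take m' (filter (\<lambda>u. u \<in> A) xs) \<in> {l. a # l \<in> E}} else S)"
        by (auto simp: indicator_def fun_eq_iff S_def Suc)
      thus ?case by (simp add: S_def)
    qed
    also have "\<dots> \<le> (\<Sum>a\<in>F. pmf \<nu> a * (if a \<in> A then ?Q m' {l. a # l \<in> E} else ?Q m E))"
    proof (intro sum_mono mult_left_mono, goal_cases)
      case (1 a)
      show ?case using Suc.IH[of m' "{l. a # l \<in> E}"] Suc.IH[of m E] by simp
    qed simp
    \<comment> \<open>For accepted \<open>a\<close> the term \<open>pmf \<nu> a * ?Q m E\<close> is
      added and subtracted, so that the rejection branch is extended to all of \<open>F\<close> and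
      sums to \<open>?Q m E\<close>.\<close>
    also have "\<dots> = (\<Sum>a\<in>F. (if a \<in> A then r * (pmf \<mu> a * ?Q m' {l. a # l \<in> E}) - r * pmf \<mu> a * ?Q m E else 0)
        + pmf \<nu> a * ?Q m E)"
      by (intro sum.cong) (auto simp: eq algebra_simps)
    \<comment> \<open>Outside \<open>A\<close> the mass of \<mu> is zero, so the case distinction
      can go; what remains is \<open>r * ?Q m E - r * ?Q m E + ?Q m E\<close>.\<close>
    also have "\<dots> = (\<Sum>a\<in>F. r * (pmf \<mu> a * ?Q m' {l. a # l \<in> E}) - r * pmf \<mu> a * ?Q m E + pmf \<nu> a * ?Q m E)"
      using sub by (intro sum.cong) (auto simp: set_pmf_iff)
    also have "\<dots> = r * (\<Sum>a\<in>F. pmf \<mu> a * ?Q m' {l. a # l \<in> E}) - r * (\<Sum>a\<in>F. pmf \<mu> a) * ?Q m E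
        + (\<Sum>a\<in>F. pmf \<nu> a) * ?Q m E"
      by (simp only: sum.distrib sum_subtractf sum_distrib_left sum_distrib_right)
    also have "\<dots> = ?Q m E"
      unfolding Q[symmetric] using F by (simp add: sum_pmf_eq_1)
    finally show ?thesis .
  qed
qed

text \<open>With eight draws per sample the moment of base 1/2 is at most
  \<open>exp (- 2 * m)\<close>, and the Markov factor \<open>2 ^ m\<close> costs at most
  \<open>exp m\<close>.\<close>

lemma prob_few_accepted:
  assumes "finite (set_pmf \<nu>)" "1 / 2 \<le> measure_pmf.prob \<nu> {x. Q x}"
  shows "measure_pmf.prob (replicate_pmf (8 * m) \<nu>) {xs. length (filter Q xs) < m} \<le> exp (- real m)"
proof -
  have "measure_pmf.prob (replicate_pmf (8 * m) \<nu>) {xs. length (filter Q xs) < m}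
     \<le> measure_pmf.expectation (replicate_pmf (8 * m) \<nu>) (\<lambda>xs. (1 / 2) ^ length (filter Q xs)) / (1 / 2) ^ m"
    by (rule prob_le_expectation_divide[OF finite_set_replicate_pmf[OF assms(1)]])
      (auto intro: power_decreasing)
  also have "\<dots> \<le> exp (- (1 / 4) * real (8 * m)) / (1 / 2) ^ m"
    using assms(2) by (intro divide_right_mono expectation_power_count_le assms) auto
  also have "\<dots> = exp (- 2 * real m) * 2 ^ m" by (simp add: power_one_over)
  also have "(2 :: real) ^ m \<le> exp 1 ^ m"
    using exp_ge_add_one_self[of 1] by (intro power_mono) auto
  also have "exp (- 2 * real m) * exp 1 ^ m = exp (- real m)"
    by (simp add: exp_of_nat2_mult[symmetric] exp_add[symmetric])
  finally show ?thesis by simp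
qed

subsection \<open>Sparsified instances\<close>

definition copies :: "(nat \<times> nat \<times> 'p) list \<Rightarrow> nat list \<Rightarrow> (nat \<times> nat \<times> 'p) list" where
  "copies es js =
    concat (map (\<lambda>(j, u). map (\<lambda>e. (j, snd e)) (filter (\<lambda>e. fst e = u) es)) (List.enumerate 0 js))"

definition deg_in :: "(nat \<times> nat \<times> 'p) list \<Rightarrow> nat \<Rightarrow> nat" where
  "deg_in es v = length (filter (\<lambda>e. fst (snd e) = v) es)"

definition edge_mult :: "sbug \<Rightarrow> nat \<Rightarrow> nat \<Rightarrow> nat" where
  "edge_mult G u v = length (filter (\<lambda>e. fst e = u \<and> fst (snd e) = v) (edges G))"

lemma left_degree_eq: "left_degree G u = length (filter (\<lambda>e. fst e = u) (edges G))"
  by (auto simp: left_degree_def intro!: arg_cong[where f = length] filter_cong)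

lemma right_degree_eq: "right_degree G v = deg_in (edges G) v"
  by (auto simp: right_degree_def deg_in_def intro!: arg_cong[where f = length] filter_cong)

text \<open>Degrees are measured before any removal, so at each right vertex either all edge copies
  survive or none does. Each sample becomes a vertex of its own, even if repeated, which makes the
  uniform measure the right one.\<close>

definition sparsify :: "nat \<Rightarrow> sbug \<Rightarrow> nat list \<Rightarrow> sbug" where
  "sparsify T G js =
    \<lparr>nleft = length js, nright = nright G, alphabet = alphabet G,
     edges = filter (\<lambda>e. deg_in (copies (edges G) js) (fst (snd e)) \<le> T) (copies (edges G) js),
     mu = pmf_of_set {..<length js}\<rparr>"

lemma in_copies_iff: "(j, v, p) \<in> set (copies es js) \<longleftrightarrow> j < length js \<and> (js ! j, v, p) \<in> set es"
proof
  assume "j < length js \<and> (js ! j, v, p) \<in> set es"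
  thus "(j, v, p) \<in> set (copies es js)"
    by (auto simp: copies_def in_set_enumerate_eq image_iff intro!: bexI[of _ "(j, js ! j)"] bexI[of _ "(js ! j, v, p)"])
next
  assume "(j, v, p) \<in> set (copies es js)"
  thus "j < length js \<and> (js ! j, v, p) \<in> set es"
    by (auto simp: copies_def in_set_enumerate_eq)
qed

lemma left_copies:
  assumes "j < length js"
  shows "length (filter (\<lambda>e. fst e = j) (copies es js)) = length (filter (\<lambda>e. fst e = js ! j) es)"
proof -
  have "length (filter (\<lambda>e. fst e = j) (concat (map (\<lambda>(j, u). map (\<lambda>e. (j, snd e))
        (filter (\<lambda>e. fst e = u) es)) (List.enumerate i js)))) =
      (if i \<le> j \<and> j < i + length js then length (filter (\<lambda>e. fst e = js ! (j - i)) es) else 0)" for i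
  proof (induction js arbitrary: i)
    case (Cons u js)
    have "length (filter (\<lambda>e. fst e = j) (map (\<lambda>e. (i, snd e)) xs)) = (if i = j then length xs else 0)"
      for xs :: "(nat \<times> nat \<times> 'a) list"
      by (simp add: filter_map o_def)
    thus ?case using Cons[of "Suc i"] by (auto simp: nth_Cons' simp del: filter_map)
  qed auto
  from this[of 0] assms show ?thesis by (simp add: copies_def)
qed

lemma deg_in_append [simp]: "deg_in (xs @ ys) v = deg_in xs v + deg_in ys v"
  by (simp add: deg_in_def)

lemma deg_in_copies: "deg_in (copies (edges G) js) v = (\<Sum>u\<leftarrow>js. edge_mult G u v)"
proof -
  have "deg_in (concat (map (\<lambda>(j, u). map (\<lambda>e. (j, snd e))
        (filter (\<lambda>e. fst e = u) (edges G))) (List.enumerate i js))) v = (\<Sum>u\<leftarrow>js. edge_mult G u v)" for i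
  proof (induction js arbitrary: i)
    case (Cons u js)
    have "deg_in (map (\<lambda>e. (i, snd e)) (filter (\<lambda>e. fst e = u) (edges G))) v = edge_mult G u v"
      by (simp add: deg_in_def edge_mult_def filter_map o_def conj_commute)
    thus ?case using Cons[of "Suc i"] by simp
  qed (simp add: deg_in_def)
  thus ?thesis by (simp add: copies_def)
qed

lemma length_filter_filter_le: "length (filter P (filter Q xs)) \<le> length (filter P xs)"
  by (induction xs) auto

lemma card_nth_eq_length_filter: "card {j. j < length js \<and> Q (js ! j)} = length (filter Q js)"
  by (simp add: length_filter_conv_card)

lemma prob_uniform_lessThan:
  fixes m :: nat
  assumes "0 < m"
  shows "measure_pmf.prob (pmf_of_set {..<m}) S = card (S \<inter> {..<m}) / m"
  using assms by (subst measure_pmf_of_set) (auto simp: Int_commute lessThan_empty_iff)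

lemma bounded_degree_sparsify:
  assumes G: "sbug_instance G" "left_regular d G" and js: "js \<noteq> []" "set js \<subseteq> {..<nleft G}"
    and T: "real T \<le> D"
  shows "bounded_degree_output d D G (sparsify T G js)"
proof -
  let ?H = "sparsify T G js"
  have edge: "(j, v, p) \<in> set (edges ?H) \<Longrightarrow> j < length js \<and> (js ! j, v, p) \<in> set (edges G)" for j v p
    by (auto simp: sparsify_def in_copies_iff)
  have "sbug_instance ?H"
    using G(1) edge js(1) unfolding sbug_instance_def
    by (fastforce simp: sparsify_def lessThan_empty_iff)
  moreover have "left_degree ?H j \<le> d" if "j < length js" for j
  proof -
    have "left_degree ?H j \<le> length (filter (\<lambda>e. fst e = j) (copies (edges G) js))"
      unfolding left_degree_eq sparsify_def sbug.simps by (rule length_filter_filter_le)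
    also have "\<dots> = left_degree G (js ! j)"
      using that by (simp add: left_copies left_degree_eq)
    also have "\<dots> = d" using G(2) js(2) that by (auto simp: left_regular_def subset_iff)
    finally show ?thesis .
  qed
  moreover have "right_degree ?H v \<le> T" for v
  proof (cases "deg_in (copies (edges G) js) v \<le> T")
    case True
    have "right_degree ?H v \<le> deg_in (copies (edges G) js) v"
      unfolding right_degree_eq sparsify_def deg_in_def sbug.simps by (rule length_filter_filter_le)
    with True show ?thesis by simp
  next
    case False
    hence "filter (\<lambda>e. fst (snd e) = v) (edges ?H) = []"
      by (auto simp: filter_empty_conv sparsify_def)
    thus ?thesis by (simp add: right_degree_eq deg_in_def)
  qed
  ultimately show ?thesis
    using T by (auto simp: bounded_degree_output_def sparsify_def intro: order_trans[of _ "real T"])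
qed

text \<open>The label of a left vertex enters only its own constraints, so satisfiability at
  \<open>u\<close> depends on the right labeling alone. The union bound then has
  \<open>k ^ n\<close> cases, whatever the number of samples.\<close>

definition good :: "sbug \<Rightarrow> (nat \<Rightarrow> nat) \<Rightarrow> nat \<Rightarrow> bool" where
  "good G \<tau> u \<longleftrightarrow> (\<exists>a < alphabet G. \<forall>(u', v, p) \<in> set (edges G). u' = u \<longrightarrow> a = p (\<tau> v))"

definition overload :: "nat \<Rightarrow> sbug \<Rightarrow> nat list \<Rightarrow> nat" where
  "overload T G js = (\<Sum>v<nright G. let x = (\<Sum>u\<leftarrow>js. edge_mult G u v) in if x \<le> T then 0 else x)"

text \<open>Each sample inherits the label of its original, and removing edges only removes
  constraints.\<close>

lemma completeness_sparsify:
  fixes \<epsilon> :: real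
  assumes \<sigma>: "labeling G \<sigma>" and js: "js \<noteq> []" "set js \<subseteq> {..<nleft G}"
    and few: "real (length (filter (\<lambda>u. \<not> all_satisfied G \<sigma> u) js)) \<le> 4 * \<epsilon> * length js"
  shows "completeness \<epsilon> G (sparsify T G js)"
  unfolding completeness_def
proof (intro impI exI conjI)
  let ?H = "sparsify T G js"
  define \<sigma>' where "\<sigma>' = case_sum (\<lambda>j. \<sigma> (Inl (js ! j))) (\<lambda>v. \<sigma> (Inr v))"
  define S where "S = {j. j < length js \<and> all_satisfied G \<sigma> (js ! j)}"
  show "S \<subseteq> {..<nleft ?H}" by (auto simp: S_def sparsify_def)
  show "labeling ?H \<sigma>'"
    using \<sigma> js(2) by (auto simp: labeling_def \<sigma>'_def sparsify_def Pi_def subset_iff PlusE InlI InrI)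
  show "\<forall>u\<in>S. all_satisfied ?H \<sigma>' u"
    by (auto simp: S_def all_satisfied_def \<sigma>'_def sparsify_def in_copies_iff)
  have "card S + length (filter (\<lambda>u. \<not> all_satisfied G \<sigma> u) js) = length js"
    unfolding S_def card_nth_eq_length_filter by (rule sum_length_filter_compl)
  hence "(1 - 4 * \<epsilon>) * length js \<le> card S" using few by (simp add: algebra_simps)
  moreover have "S \<inter> {..<length js} = S" by (auto simp: S_def)
  ultimately show "1 - 4 * \<epsilon> \<le> measure_pmf.prob (mu ?H) S"
    using js(1) by (simp add: sparsify_def prob_uniform_lessThan field_simps)
qed

text \<open>A sample that loses an edge is adjacent to an overloaded right vertex and contributes at
  least 1 to the sum at that vertex.\<close>

lemma card_affected_le:
  assumes "sbug_instance G"
  shows "card {j. j < length js \<and> (\<exists>v p. (js ! j, v, p) \<in> set (edges G) \<and> \<not> deg_in (copies (edges G) js) v \<le> T)}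
    \<le> overload T G js"
proof -
  let ?W = "{v. v < nright G \<and> \<not> (\<Sum>u\<leftarrow>js. edge_mult G u v) \<le> T}"
  have "{j. j < length js \<and> (\<exists>v p. (js ! j, v, p) \<in> set (edges G) \<and> \<not> deg_in (copies (edges G) js) v \<le> T)}
      \<subseteq> (\<Union>v\<in>?W. {j. j < length js \<and> edge_mult G (js ! j) v \<noteq> 0})"
  proof
    fix j assume "j \<in> {j. j < length js \<and> (\<exists>v p. (js ! j, v, p) \<in> set (edges G) \<and> \<not> deg_in (copies (edges G) js) v \<le> T)}"
    then obtain v p where e: "j < length js" "(js ! j, v, p) \<in> set (edges G)"
      "\<not> deg_in (copies (edges G) js) v \<le> T" by blast
    have "v < nright G" using assms e(2) by (auto simp: sbug_instance_def)
    moreover have "edge_mult G (js ! j) v \<noteq> 0"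
      using e(2) by (force simp: edge_mult_def filter_empty_conv)
    ultimately show "j \<in> (\<Union>v\<in>?W. {j. j < length js \<and> edge_mult G (js ! j) v \<noteq> 0})"
      using e by (auto simp: deg_in_copies)
  qed
  hence "card {j. j < length js \<and> (\<exists>v p. (js ! j, v, p) \<in> set (edges G) \<and> \<not> deg_in (copies (edges G) js) v \<le> T)}
      \<le> card (\<Union>v\<in>?W. {j. j < length js \<and> edge_mult G (js ! j) v \<noteq> 0})"
    by (intro card_mono) auto
  also have "\<dots> \<le> (\<Sum>v\<in>?W. card {j. j < length js \<and> edge_mult G (js ! j) v \<noteq> 0})"
    by (rule card_UN_le) simp
  also have "\<dots> \<le> (\<Sum>v\<in>?W. \<Sum>u\<leftarrow>js. edge_mult G u v)"
  proof (rule sum_mono)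
    fix v
    have "length (filter (\<lambda>u. edge_mult G u v \<noteq> 0) js) \<le> (\<Sum>u\<leftarrow>js. edge_mult G u v)"
      by (induction js) auto
    thus "card {j. j < length js \<and> edge_mult G (js ! j) v \<noteq> 0} \<le> (\<Sum>u\<leftarrow>js. edge_mult G u v)"
      using card_nth_eq_length_filter[of js "\<lambda>u. edge_mult G u v \<noteq> 0"] by simp
  qed
  also have "\<dots> = overload T G js"
    unfolding overload_def Let_def by (intro sum.mono_neutral_cong_left) auto
  finally show ?thesis .
qed

text \<open>A satisfied sample is either good for the right labeling or has lost an edge. The former
  number at most a fraction \<open>1 - \<gamma>/2\<close> of the samples, the latter at most
  \<gamma>/4.\<close>

lemma soundness_sparsify:
  fixes \<gamma> :: real
  assumes G: "sbug_instance G" and js: "js \<noteq> []"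
    and bad: "\<And>\<tau>. \<tau> \<in> {..<nright G} \<rightarrow>\<^sub>E {..<alphabet G} \<Longrightarrow>
      \<gamma> * length js / 2 \<le> real (length (filter (\<lambda>u. \<not> good G \<tau> u) js))"
    and over: "real (overload T G js) \<le> \<gamma> * length js / 4"
  shows "soundness \<gamma> G (sparsify T G js)"
  unfolding soundness_def
proof (intro impI allI)
  let ?H = "sparsify T G js"
  fix \<sigma> assume \<sigma>: "labeling ?H \<sigma>"
  \<comment> \<open>Fixing the value outside the right vertices puts \<tau> into a finite set of
    functions, over which the union bound is taken.\<close>
  define \<tau> where "\<tau> = restrict (\<lambda>v. \<sigma> (Inr v)) {..<nright G}"
  have \<tau>: "\<tau> \<in> {..<nright G} \<rightarrow>\<^sub>E {..<alphabet G}"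
    using \<sigma> by (auto simp: \<tau>_def labeling_def sparsify_def Pi_def)
  let ?S = "{j. all_satisfied ?H \<sigma> j} \<inter> {..<length js}"
  let ?A = "{j. j < length js \<and> (\<exists>v p. (js ! j, v, p) \<in> set (edges G) \<and> \<not> deg_in (copies (edges G) js) v \<le> T)}"
  have "?S \<subseteq> {j. j < length js \<and> good G \<tau> (js ! j)} \<union> ?A"
  proof
    fix j assume j: "j \<in> ?S"
    show "j \<in> {j. j < length js \<and> good G \<tau> (js ! j)} \<union> ?A"
    proof (cases "j \<in> ?A")
      case False
      have "\<sigma> (Inl j) < alphabet G"
        using \<sigma> j by (auto simp: labeling_def sparsify_def Pi_def)
      moreover have "\<sigma> (Inl j) = p (\<tau> v)" if e: "(js ! j, v, p) \<in> set (edges G)" for v p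
      proof -
        have "v < nright G" using G e by (auto simp: sbug_instance_def)
        moreover have "(j, v, p) \<in> set (edges ?H)"
          using e False j by (auto simp: sparsify_def in_copies_iff)
        ultimately show ?thesis using j by (auto simp: all_satisfied_def \<tau>_def)
      qed
      ultimately show ?thesis using j by (auto simp: good_def)
    qed simp
  qed
  hence "card ?S \<le> card ({j. j < length js \<and> good G \<tau> (js ! j)} \<union> ?A)"
    by (intro card_mono) auto
  also have "\<dots> \<le> card {j. j < length js \<and> good G \<tau> (js ! j)} + card ?A"
    by (rule card_Un_le)
  also have "\<dots> \<le> length (filter (good G \<tau>) js) + overload T G js"
    using card_affected_le[OF G, of js T] by (simp add: card_nth_eq_length_filter)
  finally have "real (card ?S) \<le> real (length (filter (good G \<tau>) js)) + real (overload T G js)"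
    by linarith
  moreover have "real (length (filter (good G \<tau>) js)) + real (length (filter (\<lambda>u. \<not> good G \<tau> u) js)) = length js"
    by (simp flip: of_nat_add add: sum_length_filter_compl)
  ultimately have "real (card ?S) \<le> (1 - \<gamma> / 4) * length js"
    using bad[OF \<tau>] over by (simp add: algebra_simps)
  thus "measure_pmf.prob (mu ?H) {u. all_satisfied ?H \<sigma> u} \<le> 1 - \<gamma> / 4"
    using js by (simp add: sparsify_def prob_uniform_lessThan divide_le_eq)
qed

lemma prob_Collect_not: "measure_pmf.prob p {x. \<not> Q x} = 1 - measure_pmf.prob p {x. Q x}"
  using measure_pmf.prob_compl[of "{x. Q x}" p] by (simp add: set_diff_eq)

text \<open>Completing \<tau> by the best label at every left vertex gives a labeling of the whole
  instance that satisfies all good vertices, to which the NO promise applies.\<close>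

lemma prob_not_good:
  assumes G: "sbug_instance G" "no_instance \<gamma> G" and \<tau>: "\<tau> \<in> {..<nright G} \<rightarrow> {..<alphabet G}"
  shows "\<gamma> \<le> measure_pmf.prob (mu G) {u. \<not> good G \<tau> u}"
proof -
  \<comment> \<open>At a vertex that is not good any label will do; one exists because the alphabet
    is nonempty.\<close>
  define a where "a u = (SOME a. a < alphabet G \<and> (good G \<tau> u \<longrightarrow> (\<forall>(u', v, p) \<in> set (edges G). u' = u \<longrightarrow> a = p (\<tau> v))))" for u
  have a: "a u < alphabet G \<and> (good G \<tau> u \<longrightarrow> (\<forall>(u', v, p) \<in> set (edges G). u' = u \<longrightarrow> a u = p (\<tau> v)))" for u
    unfolding a_def
  proof (rule someI_ex)
    have "0 < alphabet G" using G(1) by (simp add: sbug_instance_def)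
    thus "\<exists>a. a < alphabet G \<and> (good G \<tau> u \<longrightarrow> (\<forall>(u', v, p) \<in> set (edges G). u' = u \<longrightarrow> a = p (\<tau> v)))"
      unfolding good_def by (cases "good G \<tau> u") (unfold good_def, blast+)
  qed
  define \<sigma> where "\<sigma> = case_sum a \<tau>"
  have "labeling G \<sigma>" using a \<tau> by (auto simp: labeling_def \<sigma>_def Pi_def)
  hence "measure_pmf.prob (mu G) {u. all_satisfied G \<sigma> u} < 1 - \<gamma>"
    using G(2) by (auto simp: no_instance_def)
  moreover have "measure_pmf.prob (mu G) {u. good G \<tau> u} \<le> measure_pmf.prob (mu G) {u. all_satisfied G \<sigma> u}"
  proof (rule measure_pmf.finite_measure_mono)
    show "{u. good G \<tau> u} \<subseteq> {u. all_satisfied G \<sigma> u}"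
      using a by (simp add: all_satisfied_def \<sigma>_def subset_iff)
  qed simp
  moreover note prob_Collect_not[of "mu G" "good G \<tau>"]
  ultimately show ?thesis by linarith
qed

section \<open>Right uniformity and overloaded right vertices\<close>

lemma sum_edge_mult:
  assumes "sbug_instance G"
  shows "(\<Sum>v<nright G. edge_mult G u v) = left_degree G u"
proof -
  have "(\<Sum>v<n. length (filter (\<lambda>e. fst e = u \<and> fst (snd e) = v) es)) = length (filter (\<lambda>e. fst e = u) es)"
    if "\<forall>e\<in>set es. fst (snd e) < n" for n and es :: "(nat \<times> nat \<times> (nat \<Rightarrow> nat)) list"
    using that
  proof (induction es)
    case (Cons e es)
    have "(\<Sum>v<n. length (filter (\<lambda>e. fst e = u \<and> fst (snd e) = v) (e # es))) =
      (\<Sum>v<n. (if v = fst (snd e) then of_bool (fst e = u) else 0) +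
        length (filter (\<lambda>e. fst e = u \<and> fst (snd e) = v) es))"
      by (intro sum.cong) auto
    also have "\<dots> = of_bool (fst e = u) + length (filter (\<lambda>e. fst e = u) es)"
      using Cons by (simp add: sum.distrib)
    finally show ?case by simp
  qed simp
  from this[of "edges G" "nright G"] show ?thesis
    using assms by (force simp: edge_mult_def left_degree_eq sbug_instance_def)
qed

lemma edge_mult_eq_0_iff: "edge_mult G u v = 0 \<longleftrightarrow> v \<notin> neighbours G u"
  by (force simp: edge_mult_def neighbours_def filter_empty_conv)

text \<open>On average a left vertex has \<open>d\<close> distinct neighbours by right uniformity, and it never has
  more than \<open>d\<close>, so almost no left vertex has parallel edges.\<close>

lemma edge_mult_eq_of_bool:
  assumes G: "sbug_instance G" "left_regular d G" "right_uniform d G"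
    and u: "u \<in> set_pmf (mu G)" and v: "v < nright G"
  shows "edge_mult G u v = of_bool (v \<in> neighbours G u)"
proof -
  let ?n = "nright G" and ?M = "mu G"
  have fin: "finite (set_pmf ?M)"
    using G(1) finite_subset by (auto simp: sbug_instance_def)
  define N where "N u = (\<Sum>v<?n. of_bool (v \<in> neighbours G u) :: nat)" for u
  have le: "of_bool (v \<in> neighbours G u) \<le> edge_mult G u v" for u v
    using edge_mult_eq_0_iff[of G u v] by auto
  have deg: "(\<Sum>v<?n. edge_mult G u v) = d" if "u \<in> set_pmf ?M" for u
    using that G by (subst sum_edge_mult) (auto simp: sbug_instance_def left_regular_def)
  have N: "N u \<le> d" if "u \<in> set_pmf ?M" for u
    unfolding N_def deg[OF that, symmetric] by (rule sum_mono) (rule le)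
  have "(\<Sum>u\<in>set_pmf ?M. pmf ?M u * N u) = (\<Sum>v<?n. \<Sum>u\<in>set_pmf ?M. pmf ?M u * of_bool (v \<in> neighbours G u))"
    by (subst sum.swap) (simp add: N_def sum_distrib_left mult.commute)
  also have "\<dots> = (\<Sum>v<?n. measure_pmf.prob ?M {u. v \<in> neighbours G u})"
  proof (intro sum.cong refl)
    fix v
    have "measure_pmf.prob ?M {u. v \<in> neighbours G u} = measure_pmf.prob ?M ({u. v \<in> neighbours G u} \<inter> set_pmf ?M)"
      by (simp add: measure_Int_set_pmf)
    also have "\<dots> = (\<Sum>u\<in>{u. v \<in> neighbours G u} \<inter> set_pmf ?M. pmf ?M u)"
      using fin by (intro measure_measure_pmf_finite) auto
    also have "\<dots> = (\<Sum>u\<in>set_pmf ?M. pmf ?M u * of_bool (v \<in> neighbours G u))"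
      using fin by (intro sum.mono_neutral_cong_left) auto
    finally show "(\<Sum>u\<in>set_pmf ?M. pmf ?M u * of_bool (v \<in> neighbours G u)) =
        measure_pmf.prob ?M {u. v \<in> neighbours G u}" by simp
  qed
  also have "\<dots> = d" using G(3) v by (simp add: right_uniform_def)
  also have "\<dots> = (\<Sum>u\<in>set_pmf ?M. pmf ?M u * d)"
    using fin by (simp add: sum_distrib_right[symmetric] sum_pmf_eq_1)
  finally have "(\<Sum>u\<in>set_pmf ?M. pmf ?M u * (real d - N u)) = 0"
    by (simp add: algebra_simps sum_subtractf)
  \<comment> \<open>The deficits \<open>d - N u\<close> are nonnegative on the support and average
    to 0, so each of them vanishes.\<close>
  hence "pmf ?M u * (real d - N u) = 0"
    using fin u N by (subst (asm) sum_nonneg_eq_0_iff) auto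
  hence "N u = d" using u by (simp add: set_pmf_iff)
  hence "(\<Sum>v<?n. edge_mult G u v) = (\<Sum>v<?n. of_bool (v \<in> neighbours G u))"
    using deg[OF u] by (simp add: N_def)
  show ?thesis
  proof (rule ccontr)
    assume "edge_mult G u v \<noteq> of_bool (v \<in> neighbours G u)"
    hence "(\<Sum>v<?n. of_bool (v \<in> neighbours G u)) < (\<Sum>v<?n. edge_mult G u v)"
    proof (intro sum_strict_mono_ex1 bexI[of _ v])
      show "of_bool (v \<in> neighbours G u) < edge_mult G u v"
        using \<open>edge_mult G u v \<noteq> _\<close> le[of v u] by (rule le_neq_implies_less[rotated, OF not_sym])
    qed (use v le in \<open>simp_all del: of_bool_eq_iff\<close>)
    thus False using \<open>(\<Sum>v<?n. edge_mult G u v) = _\<close> by simp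
  qed
qed

lemma exp_neg_le_inverse: "0 < x \<Longrightarrow> exp (- x) \<le> 1 / (x :: real)"
proof -
  assume "0 < x"
  moreover have "x \<le> exp x" using exp_ge_add_one_self[of x] by linarith
  ultimately show ?thesis by (simp add: exp_minus inverse_eq_divide frac_le)
qed

text \<open>Beyond the threshold both \<open>x\<close> and \<open>2 ^ T\<close> are at most
  \<open>2 ^ x\<close>. The truncated count is thus dominated by one exponential, whose expectation
  is known exactly.\<close>

lemma truncate_le_exponential:
  "real (if x \<le> T then 0 else x) \<le> 4 ^ x / 2 ^ T"
proof (cases "x \<le> T")
  case False
  have "real x * 2 ^ T \<le> 2 ^ x * 2 ^ x"
    using False less_exp[of x] by (intro mult_mono power_increasing) (auto simp: of_nat_less_two_power less_imp_le)
  also have "\<dots> = (4 :: real) ^ x" by (simp add: power_mult_distrib[symmetric])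
  finally show ?thesis using False by (simp add: field_simps)
qed simp

text \<open>The threshold exceeds the mean \<open>l * d\<close> by a factor \<open>5\<close> because the moment of base \<open>4\<close> is at most
  \<open>exp (3 * l * d)\<close>, and \<open>exp 3 \<le> 2 ^ 5\<close>.\<close>

lemma prob_overload:
  fixes \<gamma> :: real
  assumes G: "sbug_instance G" "left_regular d G" "right_uniform d G"
    and n: "0 < nright G" and l: "0 < l" and \<gamma>: "0 < \<gamma>"
  shows "measure_pmf.prob (replicate_pmf (l * nright G) (mu G))
      {js. real (overload (5 * l * d) G js) > \<gamma> * (l * nright G) / 4} \<le> 4 / (\<gamma> * l)"
proof -
  let ?n = "nright G" and ?m = "l * nright G" and ?T = "5 * l * d"
  let ?c = "\<lambda>v js. length (filter (\<lambda>u. v \<in> neighbours G u) js)"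
  have fin: "finite (set_pmf (mu G))"
    using G(1) finite_subset by (auto simp: sbug_instance_def)
  note fin' = finite_set_replicate_pmf[OF fin]
  have a: "0 < \<gamma> * ?m / 4" using n l \<gamma> by simp
  have "measure_pmf.prob (replicate_pmf ?m (mu G)) {js. real (overload ?T G js) > \<gamma> * ?m / 4}
     \<le> measure_pmf.expectation (replicate_pmf ?m (mu G)) (\<lambda>js. \<Sum>v<?n. (4 :: real) ^ ?c v js / 2 ^ ?T) / (\<gamma> * ?m / 4)"
  proof (rule prob_le_expectation_divide[OF fin' a])
    fix js assume js: "js \<in> set_pmf (replicate_pmf ?m (mu G))"
    show "0 \<le> (\<Sum>v<?n. 4 ^ ?c v js / 2 ^ ?T :: real)" by (intro sum_nonneg) auto
    assume "js \<in> {js. real (overload ?T G js) > \<gamma> * ?m / 4}"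
    hence "\<gamma> * ?m / 4 \<le> real (overload ?T G js)" by simp
    also have "\<dots> = (\<Sum>v<?n. real (if (\<Sum>u\<leftarrow>js. edge_mult G u v) \<le> ?T then 0 else (\<Sum>u\<leftarrow>js. edge_mult G u v)))"
      by (simp add: overload_def Let_def)
    also have "\<dots> \<le> (\<Sum>v<?n. 4 ^ ?c v js / 2 ^ ?T)"
    proof (rule sum_mono)
      fix v assume "v \<in> {..<?n}"
      hence "(\<Sum>u\<leftarrow>js. edge_mult G u v) = (\<Sum>u\<leftarrow>js. of_bool (v \<in> neighbours G u))"
        using js by (intro arg_cong[where f = sum_list] map_cong)
          (auto simp: set_replicate_pmf edge_mult_eq_of_bool[OF G])
      also have "\<dots> = ?c v js" by (induction js) auto
      finally show "real (if (\<Sum>u\<leftarrow>js. edge_mult G u v) \<le> ?T then 0 else (\<Sum>u\<leftarrow>js. edge_mult G u v)) \<le> 4 ^ ?c v js / 2 ^ ?T"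
        by (simp only: truncate_le_exponential)
    qed
    finally show "\<gamma> * ?m / 4 \<le> (\<Sum>v<?n. 4 ^ ?c v js / 2 ^ ?T)" .
  qed
  also have "measure_pmf.expectation (replicate_pmf ?m (mu G)) (\<lambda>js. \<Sum>v<?n. (4 :: real) ^ ?c v js / 2 ^ ?T)
     = (\<Sum>v<?n. measure_pmf.expectation (replicate_pmf ?m (mu G)) (\<lambda>js. (4 :: real) ^ ?c v js) / 2 ^ ?T)"
    using fin' by (subst Bochner_Integration.integral_sum) (auto intro: integrable_measure_pmf_finite)
  \<comment> \<open>Each right vertex contributes at most 1 in expectation: its count has mean
    \<open>l * d\<close>, and the divisor \<open>2 ^ ?T\<close> equals
    \<open>(2 ^ 5) ^ (l * d)\<close>.\<close>
  also have "\<dots> \<le> (\<Sum>v<?n. 1)"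
  proof (rule sum_mono)
    fix v assume "v \<in> {..<?n}"
    hence "measure_pmf.expectation (replicate_pmf ?m (mu G)) (\<lambda>js. (4 :: real) ^ ?c v js) \<le> exp ((3 * (d / ?n)) * ?m)"
      using G(3) by (intro expectation_power_count_le fin) (auto simp: right_uniform_def)
    also have "(3 * (d / ?n)) * ?m = real (l * d) * 3" using n by (simp add: field_simps)
    also have "exp (real (l * d) * 3) = exp 3 ^ (l * d)" by (rule exp_of_nat_mult)
    also have "\<dots> \<le> (2 ^ 5) ^ (l * d)"
    proof (rule power_mono)
      have "exp (3 :: real) = exp 1 ^ 3" by (simp add: exp_of_nat_mult[symmetric])
      also have "\<dots> \<le> 3 ^ 3" using exp_le by (intro power_mono) auto
      finally show "exp (3 :: real) \<le> 2 ^ 5" by simp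
    qed simp
    finally have "measure_pmf.expectation (replicate_pmf ?m (mu G)) (\<lambda>js. (4 :: real) ^ ?c v js) \<le> (2 ^ 5) ^ (l * d)" .
    thus "measure_pmf.expectation (replicate_pmf ?m (mu G)) (\<lambda>js. (4 :: real) ^ ?c v js) / 2 ^ ?T \<le> 1"
      by (simp add: power_mult mult.assoc)
  qed
  also have "(\<Sum>v<?n. 1 :: real) / (\<gamma> * ?m / 4) = 4 / (\<gamma> * l)"
    using n l \<gamma> by (simp add: field_simps)
  finally show ?thesis using a by (simp add: divide_right_mono)
qed

text \<open>For one right labeling the lower tail bound applies to the number of samples that are
  not good; the union over all of them costs the factor \<open>k ^ n\<close>.\<close>

lemma prob_unsound:
  fixes \<gamma> :: real
  assumes G: "sbug_instance G" "no_instance \<gamma> G" and \<gamma>: "0 < \<gamma>"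
    and b: "ln (alphabet G) \<le> real b" "0 < b" and n: "0 < nright G"
    and K: "72 \<le> K" "K \<le> c * \<gamma>"
  shows "measure_pmf.prob (replicate_pmf (c * b * nright G) (mu G))
      {js. \<exists>\<tau>\<in>{..<nright G} \<rightarrow>\<^sub>E {..<alphabet G}.
         real (length (filter (\<lambda>u. \<not> good G \<tau> u) js)) < \<gamma> * (c * b * nright G) / 2} \<le> 8 / K"
proof -
  let ?n = "nright G" and ?k = "alphabet G" and ?m = "c * b * nright G"
  let ?F = "{..<?n} \<rightarrow>\<^sub>E {..<?k}"
  let ?B = "\<lambda>\<tau>. {js. real (length (filter (\<lambda>u. \<not> good G \<tau> u) js)) < \<gamma> * ?m / 2}"
  let ?P = "measure_pmf.prob (replicate_pmf ?m (mu G))"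
  have fin: "finite (set_pmf (mu G))"
    using G(1) finite_subset by (auto simp: sbug_instance_def)
  have k: "0 < ?k" using G(1) by (simp add: sbug_instance_def)
  have "?P {js. \<exists>\<tau>\<in>?F. real (length (filter (\<lambda>u. \<not> good G \<tau> u) js)) < \<gamma> * ?m / 2} = ?P (\<Union>\<tau>\<in>?F. ?B \<tau>)"
    by (rule arg_cong[where f = ?P]) auto
  also have "\<dots> \<le> (\<Sum>\<tau>\<in>?F. ?P (?B \<tau>))"
    by (intro measure_pmf.finite_measure_subadditive_finite finite_PiE) auto
  also have "\<dots> \<le> (\<Sum>\<tau>\<in>?F. exp (- (11 / 72) * \<gamma> * ?m))"
  proof (rule sum_mono)
    fix \<tau> assume "\<tau> \<in> ?F"
    hence "\<tau> \<in> {..<?n} \<rightarrow> {..<?k}" by auto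
    from prob_not_good[OF G this] show "?P (?B \<tau>) \<le> exp (- (11 / 72) * \<gamma> * ?m)"
      using fin \<gamma> by (intro prob_count_less) auto
  qed
  also have "\<dots> = real ?k ^ ?n * exp (- (11 / 72) * \<gamma> * ?m)"
    by (simp add: card_PiE)
  also have "real ?k = exp (ln ?k)" using k by simp
  also have "exp (ln ?k) ^ ?n * exp (- (11 / 72) * \<gamma> * ?m) = exp (?n * ln ?k - (11 / 72) * \<gamma> * ?m)"
    by (simp add: exp_of_nat_mult[symmetric] exp_add[symmetric])
  \<comment> \<open>The exponent is at most \<open>(1 - 11/72 * K) * n * b\<close>. Since
    \<open>11/72 - 1/8 = 1/36\<close>, the 1 is absorbed as soon as \<open>K / 36 \<ge> 1\<close>,
    and \<open>n * b \<ge> 1\<close> finishes.\<close>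
  also have "\<dots> \<le> exp (- (K / 8))"
  proof -
    have "1 * 1 \<le> real ?n * real b" using n b by (intro mult_mono) auto
    moreover have "?n * ln ?k \<le> ?n * real b" using b by (intro mult_left_mono) auto
    moreover have "(c * \<gamma>) * (?n * real b) \<ge> K * (?n * real b)" using K by (intro mult_right_mono) auto
    moreover have "(1 - 11 / 72 * K) * (?n * real b) \<le> (- (K / 8)) * (?n * real b)"
      using K by (intro mult_right_mono) auto
    moreover have "(- (K / 8)) * (?n * real b) \<le> - (K / 8)"
      using K \<open>1 * 1 \<le> real ?n * real b\<close> by (simp add: mult_le_cancel_left1)
    ultimately show ?thesis unfolding exp_le_cancel_iff by (simp add: algebra_simps)
  qed
  also have "\<dots> \<le> 1 / (K / 8)" using K by (intro exp_neg_le_inverse) auto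
  finally show ?thesis by simp
qed

text \<open>Three bad events: too many dropped edges (\<open>4 / K\<close>), an unsound sample
  (\<open>8 / K\<close>), a sample with too many violated vertices (\<open>1 / K\<close>).\<close>

lemma prob_sparsify_fails:
  fixes \<gamma> :: real
  assumes G: "sbug_instance G" "left_regular d G" "right_uniform d G"
    and b: "ln (alphabet G) \<le> real b" "0 < b" and n: "0 < nright G"
    and \<epsilon>: "0 < \<epsilon>" "\<epsilon> < 1" "\<epsilon>\<^sup>2 \<le> \<gamma>" and K: "72 \<le> K" "K \<le> c * \<epsilon>\<^sup>2"
  shows "measure_pmf.prob (replicate_pmf (c * b * nright G) (mu G))
      {js. \<not> (completeness \<epsilon> G (sparsify (5 * (c * b) * d) G js) \<and>
              soundness \<gamma> G (sparsify (5 * (c * b) * d) G js))} \<le> 13 / K"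
proof -
  let ?n = "nright G" and ?k = "alphabet G" and ?m = "c * b * nright G" and ?T = "5 * (c * b) * d"
  let ?R = "replicate_pmf ?m (mu G)"
  let ?P = "measure_pmf.prob ?R"
  have \<gamma>: "0 < \<gamma>" using \<epsilon> by (smt (verit) zero_less_power)
  have fin: "finite (set_pmf (mu G))"
    using G(1) finite_subset by (auto simp: sbug_instance_def)
  have c\<gamma>: "K \<le> c * \<gamma>" using K \<epsilon> by (smt (verit) mult_left_mono of_nat_0_le_iff)
  have c: "0 < c" using K by (cases c) auto
  define B1 where "B1 = {js. real (overload ?T G js) > \<gamma> * ?m / 4}"
  define B2 where "B2 = (if no_instance \<gamma> G then {js. \<exists>\<tau>\<in>{..<nright G} \<rightarrow>\<^sub>E {..<alphabet G}.
         real (length (filter (\<lambda>u. \<not> good G \<tau> u) js)) < \<gamma> * ?m / 2} else {})"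
  \<comment> \<open>One near-optimal labeling is fixed before sampling, so completeness needs no
    union bound.\<close>
  define \<sigma> where "\<sigma> = (SOME \<sigma>. labeling G \<sigma> \<and> measure_pmf.prob (mu G) {u. all_satisfied G \<sigma> u} \<ge> 1 - \<epsilon>)"
  define B3 where "B3 = (if yes_instance \<epsilon> G then
      {js. real (length (filter (\<lambda>u. \<not> all_satisfied G \<sigma> u) js)) > 4 * \<epsilon> * ?m} else {})"
  have "?P B1 \<le> 4 / (\<gamma> * (c * b))"
    using prob_overload[OF G n, of "c * b" \<gamma>] c b \<gamma> by (simp add: B1_def)
  also have "\<dots> \<le> 4 / K"
  proof (rule divide_left_mono)
    have "c * \<gamma> * 1 \<le> c * \<gamma> * b" using b \<gamma> by (intro mult_left_mono) auto
    thus "K \<le> \<gamma> * real (c * b)" using c\<gamma> by (simp add: algebra_simps)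
  qed (use K \<gamma> c b in auto)
  finally have P1: "?P B1 \<le> 4 / K" .
  have P2: "?P B2 \<le> 8 / K"
    using prob_unsound[OF G(1) _ \<gamma> b n K(1) c\<gamma>] K by (auto simp: B2_def)
  have \<sigma>: "labeling G \<sigma> \<and> measure_pmf.prob (mu G) {u. all_satisfied G \<sigma> u} \<ge> 1 - \<epsilon>" if "yes_instance \<epsilon> G"
    using that unfolding \<sigma>_def yes_instance_def by (rule someI_ex)
  have P3: "?P B3 \<le> 1 / K"
  proof (cases "yes_instance \<epsilon> G")
    case True
    have "measure_pmf.prob (mu G) {u. \<not> all_satisfied G \<sigma> u} \<le> \<epsilon>"
      using \<sigma>[OF True] prob_Collect_not[of "mu G" "all_satisfied G \<sigma>"] by simp
    hence "?P B3 \<le> exp (- \<epsilon> * ?m)"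
      using prob_count_greater[OF fin, of "\<lambda>u. \<not> all_satisfied G \<sigma> u" \<epsilon> ?m] True \<epsilon> by (simp add: B3_def)
    also have "\<dots> \<le> exp (- K)"
    proof -
      \<comment> \<open>As \<epsilon> < 1, the choice of \<open>c\<close> for the square of
        \<epsilon> leaves room for the tail bound, whose exponent is linear in \<epsilon>.\<close>
      have "c * \<epsilon>\<^sup>2 \<le> c * \<epsilon>" using \<epsilon> by (intro mult_left_mono) (auto simp: power2_eq_square mult_le_cancel_left1)
      also have "\<dots> = \<epsilon> * real (c * 1 * 1)" by simp
      also have "\<dots> \<le> \<epsilon> * real ?m"
        using \<epsilon> b n by (intro mult_left_mono of_nat_mono mult_le_mono) auto
      finally show ?thesis using K by simp
    qed
    also have "\<dots> \<le> 1 / K" using K by (intro exp_neg_le_inverse) auto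
    finally show ?thesis .
  qed (use K in \<open>simp add: B3_def\<close>)
  let ?bad = "{js. \<not> (completeness \<epsilon> G (sparsify ?T G js) \<and> soundness \<gamma> G (sparsify ?T G js))}"
  have "?P ?bad = ?P (?bad \<inter> set_pmf ?R)" by (simp add: measure_Int_set_pmf)
  also have "\<dots> \<le> ?P (B1 \<union> B2 \<union> B3)"
  proof (rule measure_pmf.finite_measure_mono)
    show "?bad \<inter> set_pmf ?R \<subseteq> B1 \<union> B2 \<union> B3"
    proof
      fix js assume js: "js \<in> ?bad \<inter> set_pmf ?R"
      have len: "length js = ?m" and sub: "set js \<subseteq> {..<nleft G}"
        using js G(1) by (auto simp: set_replicate_pmf sbug_instance_def)
      have ne: "js \<noteq> []" using len c b n by auto
      show "js \<in> B1 \<union> B2 \<union> B3"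
      proof (rule ccontr)
        assume *: "js \<notin> B1 \<union> B2 \<union> B3"
        have "completeness \<epsilon> G (sparsify ?T G js)"
        proof (cases "yes_instance \<epsilon> G")
          case True
          with * show ?thesis
            by (intro completeness_sparsify[of _ \<sigma>]) (use \<sigma> ne sub len in \<open>auto simp: B3_def not_less\<close>)
        qed (simp add: completeness_def)
        moreover have "soundness \<gamma> G (sparsify ?T G js)"
        proof (cases "no_instance \<gamma> G")
          case True
          with * show ?thesis
            by (intro soundness_sparsify) (use G ne len in \<open>auto simp: B1_def B2_def not_less\<close>)
        qed (simp add: soundness_def)
        ultimately show False using js by simp
      qed
    qed
  qed simp
  also have "\<dots> \<le> ?P B1 + ?P B2 + ?P B3"
    using measure_Un_le[of B1 ?R B2] measure_Un_le[of "B1 \<union> B2" ?R B3] by simp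
  also have "\<dots> \<le> 13 / K" using P1 P2 P3 by simp
  finally show ?thesis .
qed

subsection \<open>Specification of the tree program\<close>

lemma tmult_enc_nat_left: "tmult (enc_nat c) t = enc_nat (c * length (dec t))"
  using enc_nat_eqI[of "tmult (enc_nat c) t"] set_tmult[of "enc_nat c" t]
    set_replicate_subset[of c Atom]
  by (simp add: subset_trans)

lemma enc_nat_eq_Atom [simp]: "enc_nat n = Atom \<longleftrightarrow> n = 0"
  by (simp add: enc_nat_def)

lemma enc_nat_Suc: "enc_nat (Suc n) = Node Atom (enc_nat n)"
  by (simp add: enc_nat_def)

lemma binary_spec:
  assumes "t \<noteq> Atom"
  shows "val (binary t) = length (dec t)" "canonical (binary t)"
proof -
  have *: "val (fold (\<lambda>_ acc. tadd t acc (Node (Node Atom Atom) Atom)) xs acc) = val acc + length xs"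
    if "val acc + length xs < 2 ^ length (dec t)" for xs :: "tree list" and acc
    using that by (induction xs arbitrary: acc) (auto simp: val_tadd)
  have "canonical (fold (\<lambda>_ acc. tadd t acc (Node (Node Atom Atom) Atom)) xs acc)"
    if "canonical acc" for xs :: "tree list" and acc
    using that by (induction xs arbitrary: acc) (auto simp: canonical_tadd)
  from this[of Atom] show "canonical (binary t)" by (simp add: binary_def canonical_def)
  show "val (binary t) = length (dec t)"
    using *[of Atom "dec t"] by (simp add: binary_def less_exp)
qed

text \<open>Applied to the total weight, the second bound gives acceptance with probability at least
  1/2, and the third bounds the number of random bits per draw by the input size.\<close>

lemma canonical_bounds:
  assumes "canonical t"
  shows "val t < 2 ^ length (dec t)" "0 < val t \<Longrightarrow> 2 ^ length (dec t) \<le> 2 * val t"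
    "val t < 2 ^ n \<Longrightarrow> length (dec t) \<le> n"
proof -
  show "val t < 2 ^ length (dec t)" by (rule val_less)
  have *: "2 ^ length (dec t) \<le> 2 * val t" if "t \<noteq> Atom"
    using assms that by (cases t) (auto simp: canonical_def)
  thus "0 < val t \<Longrightarrow> 2 ^ length (dec t) \<le> 2 * val t" by force
  assume n: "val t < 2 ^ n"
  show "length (dec t) \<le> n"
  proof (cases "t = Atom")
    case False
    have "(2::nat) ^ length (dec t) < 2 ^ Suc n" using *[OF False] n by simp
    hence "length (dec t) < Suc n" by (subst (asm) power_strict_increasing_iff) auto
    thus ?thesis by simp
  qed simp
qed

lemma length_width: "length (dec (width ws)) = (\<Sum>w\<leftarrow>dec ws. length (dec w))"
proof -
  have "length (dec (fold trev_append xs acc)) = (\<Sum>w\<leftarrow>xs. length (dec w)) + length (dec acc)" for xs acc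
    by (induction xs arbitrary: acc) auto
  thus ?thesis by (simp add: width_def)
qed

lemma length_width_le: "length (dec (width ws)) \<le> size ws"
  unfolding length_width by (induction ws rule: dec.induct) (auto intro: le_SucI add_mono length_dec_le)

text \<open>Inductively, a sum \<open>a + b\<close> with \<open>a < 2 ^ l\<close> and
  \<open>b < 2 ^ s\<close> stays below \<open>(a + 1) * 2 ^ s \<le> 2 ^ (l + s)\<close>.\<close>

lemma sum_val_less_width: "(\<Sum>w\<leftarrow>dec ws. val w) < 2 ^ length (dec (width ws))"
proof -
  have "(\<Sum>w\<leftarrow>xs. val w) < 2 ^ (\<Sum>w\<leftarrow>xs. length (dec w))" for xs
  proof (induction xs)
    case (Cons x xs)
    have "(\<Sum>w\<leftarrow>x # xs. val w) + 1 \<le> val x + 2 ^ (\<Sum>w\<leftarrow>xs. length (dec w))" using Cons by simp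
    also have "\<dots> \<le> val x * 2 ^ (\<Sum>w\<leftarrow>xs. length (dec w)) + 2 ^ (\<Sum>w\<leftarrow>xs. length (dec w))" by simp
    also have "\<dots> = (val x + 1) * 2 ^ (\<Sum>w\<leftarrow>xs. length (dec w))" by (simp add: algebra_simps)
    also have "\<dots> \<le> 2 ^ length (dec x) * 2 ^ (\<Sum>w\<leftarrow>xs. length (dec w))"
      using val_less[of x] by (intro mult_right_mono) auto
    finally show ?case by (simp add: power_add)
  qed simp
  thus ?thesis by (simp add: length_width)
qed

lemma prefix_sums_snoc:
  "prefix_sums w (enc_list (xs @ [x])) =
    Node (tadd w (thd (prefix_sums w (enc_list xs))) x) (prefix_sums w (enc_list xs))"
  by (simp add: prefix_sums_def)

lemma prefix_sums_spec:
  assumes "(\<Sum>x\<leftarrow>xs. val x) < 2 ^ length (dec w)"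
  shows "val (thd (prefix_sums w (enc_list xs))) = (\<Sum>x\<leftarrow>xs. val x) \<and>
    map val (dec (prefix_sums w (enc_list xs))) = rev (map (\<lambda>i. \<Sum>x\<leftarrow>take (Suc i) xs. val x) [0..<length xs])"
  using assms
proof (induction xs rule: rev_induct)
  case (snoc x xs)
  have "map (\<lambda>i. \<Sum>x\<leftarrow>take (Suc i) (xs @ [x]). val x) [0..<length xs] =
      map (\<lambda>i. \<Sum>x\<leftarrow>take (Suc i) xs. val x) [0..<length xs]"
    by (intro map_cong) auto
  thus ?case using snoc by (simp add: prefix_sums_snoc val_tadd)
qed (simp add: prefix_sums_def)

lemma rank_spec:
  "rank w r ps = enc_nat (length (filter (\<lambda>s. s mod 2 ^ length (dec w) \<le> val r mod 2 ^ length (dec w)) (map val (dec ps))))"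
proof -
  have "dec (rank w r ps) = rev (map (\<lambda>_. Atom) (filter (\<lambda>s. \<not> tless w r s) (dec ps)))"
    unfolding rank_def dec_fold_Node_if by simp
  hence "dec (rank w r ps) = replicate (length (filter (\<lambda>s. \<not> tless w r s) (dec ps))) Atom"
    by (simp add: map_replicate_const)
  hence "rank w r ps = enc_nat (length (filter (\<lambda>s. \<not> tless w r s) (dec ps)))"
    by (metis enc_list_dec enc_nat_def)
  thus ?thesis by (simp add: filter_map o_def tless_iff not_less)
qed

lemma tdrop_enc_bits: "tdrop t (enc_bits bs) = enc_bits (drop (length (dec t)) bs)"
proof -
  have "dec (tdrop t (enc_bits bs)) = dec (enc_bits (drop (length (dec t)) bs))"
    by (simp add: enc_bits_def drop_map)
  thus ?thesis by (metis enc_list_dec)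
qed

section \<open>Distribution of the draws\<close>

text \<open>A uniform \<open>R\<close> below a bound is turned into \<open>u < n\<close> with probability proportional to \<open>w u\<close>; the
  value \<open>n\<close> means rejection.\<close>

definition draw :: "(nat \<Rightarrow> nat) \<Rightarrow> nat \<Rightarrow> nat \<Rightarrow> nat" where
  "draw w n R = card {i. i < n \<and> (\<Sum>j\<le>i. w j) \<le> R}"

text \<open>Prefix sums increase, so the indices counted by \<open>draw\<close> form an initial
  segment, and its cardinality is the first index whose prefix sum exceeds \<open>R\<close>.\<close>

lemma draw_eq_iff:
  assumes "u < n"
  shows "draw w n R = u \<longleftrightarrow> (\<Sum>j<u. w j) \<le> R \<and> R < (\<Sum>j\<le>u. w j)"
proof -
  define D where "D = {i. i < n \<and> (\<Sum>j\<le>i. w j) \<le> R}"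
  have mono: "(\<Sum>j\<le>a. w j) \<le> (\<Sum>j\<le>b. w j)" if "a \<le> b" for a b
    using that by (intro sum_mono2) auto
  have finD: "finite D" by (simp add: D_def)
  show ?thesis
  proof
    assume *: "(\<Sum>j<u. w j) \<le> R \<and> R < (\<Sum>j\<le>u. w j)"
    have "D = {..<u}"
    proof (intro set_eqI iffI)
      fix i assume "i \<in> D"
      hence "(\<Sum>j\<le>i. w j) \<le> R" by (simp add: D_def)
      hence "\<not> u \<le> i" using mono[of u i] * by linarith
      thus "i \<in> {..<u}" by simp
    next
      fix i assume i: "i \<in> {..<u}"
      hence "(\<Sum>j\<le>i. w j) \<le> (\<Sum>j<u. w j)" by (intro sum_mono2) auto
      thus "i \<in> D" using * i assms by (simp add: D_def)
    qed
    thus "draw w n R = u" by (simp add: draw_def D_def[symmetric])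
  next
    assume "draw w n R = u"
    hence card: "card D = u" by (simp add: draw_def D_def)
    have down: "{..i} \<subseteq> D" if "i \<in> D" for i
    proof
      fix j assume "j \<in> {..i}"
      thus "j \<in> D" using that mono[of j i] by (simp add: D_def)
    qed
    have "u \<notin> D"
    proof
      assume "u \<in> D"
      from card_mono[OF finD down[OF this]] card show False by simp
    qed
    moreover have "u - 1 \<in> D" if "u \<noteq> 0"
    proof (rule ccontr)
      assume *: "u - 1 \<notin> D"
      have "D \<subseteq> {..<u - 1}"
      proof
        fix i assume i: "i \<in> D"
        show "i \<in> {..<u - 1}" using down[OF i] * by (auto simp: not_less intro: ccontr)
      qed
      from card_mono[OF _ this] card that show False by simp
    qed
    moreover have "(\<Sum>j\<le>u - 1. w j) = (\<Sum>j<u. w j)" if "u \<noteq> 0"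
      using that by (intro sum.cong) auto
    ultimately show "(\<Sum>j<u. w j) \<le> R \<and> R < (\<Sum>j\<le>u. w j)"
      using assms by (cases "u = 0") (auto simp: D_def)
  qed
qed

lemma card_draw_eq:
  assumes "u < n" "(\<Sum>j<n. w j) \<le> M"
  shows "card {R. R < M \<and> draw w n R = u} = w u"
proof -
  have "(\<Sum>j\<le>u. w j) \<le> (\<Sum>j<n. w j)" using assms(1) by (intro sum_mono2) auto
  hence "{R. R < M \<and> draw w n R = u} = {(\<Sum>j<u. w j)..<(\<Sum>j\<le>u. w j)}"
    using assms by (auto simp: draw_eq_iff)
  thus ?thesis by (simp flip: lessThan_Suc_atMost)
qed

fun draws :: "(nat \<Rightarrow> nat) \<Rightarrow> nat \<Rightarrow> nat \<Rightarrow> nat \<Rightarrow> bool list \<Rightarrow> nat list" where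
  "draws w n s 0 bs = []"
| "draws w n s (Suc m) bs = draw w n (bits_val (take s bs)) # draws w n s m (drop s bs)"

lemma bij_betw_bits_val: "bij_betw bits_val {bs. length bs = s} {..<2 ^ s}"
proof -
  have inj: "inj_on bits_val {bs. length bs = s}"
  proof (rule inj_onI)
    fix as bs :: "bool list"
    assume "as \<in> {bs. length bs = s}" "bs \<in> {bs. length bs = s}" "bits_val as = bits_val bs"
    hence "length as = length bs" "bits_val as = bits_val bs" by auto
    thus "as = bs"
    proof (induction as bs rule: list_induct2)
      case (Cons a as b bs)
      from Cons.prems have "(of_bool a + 2 * bits_val as) mod 2 = (of_bool b + 2 * bits_val bs) mod (2 :: nat)"
        by simp
      hence "a = b" by (cases a; cases b) simp_all
      thus ?case using Cons by simp
    qed simp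
  qed
  have fin: "finite {bs :: bool list. length bs = s}" and card: "card {bs :: bool list. length bs = s} = 2 ^ s"
    using finite_lists_length_eq[of "UNIV :: bool set" s] card_lists_length_eq[of "UNIV :: bool set" s] by auto
  have "bits_val ` {bs. length bs = s} = {..<2 ^ s}"
  proof (rule card_subset_eq)
    show "bits_val ` {bs. length bs = s} \<subseteq> {..<2 ^ s}"
      using val_less by (auto simp: val_enc_bits[symmetric] enc_bits_def)
         (metis (no_types) dec_enc_list length_map val_less)
    show "card (bits_val ` {bs. length bs = s}) = card {..<(2::nat) ^ s}"
      using card_image[OF inj] card by simp
  qed simp
  with inj show ?thesis by (simp add: bij_betw_def)
qed

lemma finite_bit_lists: "finite {bs :: bool list. length bs = s}"
  using finite_lists_length_eq[of "UNIV :: bool set" s] by simp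

lemma bit_lists_nonempty: "{bs :: bool list. length bs = s} \<noteq> {}"
  using length_replicate[of s True] by blast

lemma pmf_of_bit_lists_append:
  "pmf_of_set {bs :: bool list. length bs = a + b} =
    do {xs \<leftarrow> pmf_of_set {bs. length bs = a}; ys \<leftarrow> pmf_of_set {bs. length bs = b}; return_pmf (xs @ ys)}"
proof -
  let ?L = "\<lambda>n. {bs :: bool list. length bs = n}"
  have bij: "bij_betw (\<lambda>(xs, ys). xs @ ys) (?L a \<times> ?L b) (?L (a + b))"
    by (rule bij_betw_byWitness[where f' = "\<lambda>zs. (take a zs, drop a zs)"]) auto
  have "pmf_of_set (?L (a + b)) = map_pmf (\<lambda>(xs, ys). xs @ ys) (pmf_of_set (?L a \<times> ?L b))"
    by (rule map_pmf_of_set_bij_betw[OF bij, symmetric])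
       (use bit_lists_nonempty finite_bit_lists in auto)
  also have "pmf_of_set (?L a \<times> ?L b) = pair_pmf (pmf_of_set (?L a)) (pmf_of_set (?L b))"
    using bit_lists_nonempty finite_bit_lists
    by (intro pmf_eqI) (auto simp: pmf_pair pmf_of_set indicator_def card_cartesian_product)
  finally show ?thesis
    by (simp add: pair_pmf_def map_bind_pmf)
qed

text \<open>Disjoint blocks of a uniform tape are independent and uniform. The tape may be longer
  than needed; unread bits integrate out.\<close>

lemma map_pmf_draws:
  assumes "m * s \<le> N"
  shows "map_pmf (draws w n s m) (pmf_of_set {bs. length bs = N}) =
    replicate_pmf m (map_pmf (\<lambda>bs. draw w n (bits_val bs)) (pmf_of_set {bs. length bs = s}))"
  using assms
proof (induction m arbitrary: N)
  case 0
  have "draws w n s 0 = (\<lambda>_. [])" by auto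
  thus ?case by simp
next
  case (Suc m)
  let ?U = "\<lambda>n. pmf_of_set {bs :: bool list. length bs = n}"
  have N: "N = s + (N - s)" "m * s \<le> N - s" using Suc.prems by auto
  have "map_pmf (draws w n s (Suc m)) (?U N) =
      do {xs \<leftarrow> ?U s; ys \<leftarrow> ?U (N - s); return_pmf (draws w n s (Suc m) (xs @ ys))}"
    by (subst N(1), subst pmf_of_bit_lists_append) (simp add: map_bind_pmf)
  also have "\<dots> = do {xs \<leftarrow> ?U s; ys \<leftarrow> ?U (N - s); return_pmf (draw w n (bits_val xs) # draws w n s m ys)}"
    by (intro bind_pmf_cong refl) (simp add: set_pmf_of_set[OF bit_lists_nonempty finite_bit_lists])
  also have "\<dots> = do {xs \<leftarrow> ?U s; us \<leftarrow> map_pmf (draws w n s m) (?U (N - s)); return_pmf (draw w n (bits_val xs) # us)}"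
    by (simp add: bind_map_pmf)
  also have "\<dots> = replicate_pmf (Suc m) (map_pmf (\<lambda>bs. draw w n (bits_val bs)) (?U s))"
    by (simp add: Suc.IH[OF N(2)] bind_map_pmf)
  finally show ?case .
qed

text \<open>Samples are consed, hence the reversal, and the accumulator is arbitrary for the
  induction. After \<open>m\<close> samples the loop keeps consuming tape but accepts nothing
  more.\<close>

lemma sample_loop:
  assumes "\<And>bs. rank S (enc_bits bs) ps = enc_nat (draw w n (bits_val (take (length (dec S)) bs)))"
  shows "(sample_step S ps (enc_nat n) (enc_nat m) ^^ M) (Node (enc_bits bs) (enc_list (map enc_nat acc))) =
    Node (enc_bits (drop (M * length (dec S)) bs)) (enc_list (map enc_nat
      (rev (take (m - length acc) (filter (\<lambda>u. u < n) (draws w n (length (dec S)) M bs))) @ acc)))"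
proof (induction M arbitrary: bs acc)
  case (Suc M)
  let ?s = "length (dec S)"
  define i where "i = draw w n (bits_val (take ?s bs))"
  define acc' where "acc' = (if n \<le> i \<or> m \<le> length acc then acc else i # acc)"
  have "sample_step S ps (enc_nat n) (enc_nat m) (Node (enc_bits bs) (enc_list (map enc_nat acc))) =
     Node (enc_bits (drop ?s bs)) (enc_list (map enc_nat acc'))"
    by (simp add: sample_step_def assms tle_iff tdrop_enc_bits acc'_def i_def[symmetric])
  moreover have "rev (take (m - length acc') xs) @ acc' =
      rev (take (m - length acc) (if i < n then i # xs else xs)) @ acc" for xs
    by (cases "m - length acc") (auto simp: acc'_def Suc_diff_le intro: arg_cong2[where f = take])
  ultimately show ?case
    by (simp add: funpow_Suc_right Suc i_def[symmetric] ac_simps del: funpow.simps)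
qed simp

section \<open>Specification of the edge-list programs\<close>

lemma number_spec:
  "number (enc_nat (length js)) (enc_list (map enc_nat (rev js))) =
    enc_list (map (\<lambda>(j, u). Node (enc_nat j) (enc_nat u)) (List.enumerate 0 js))"
proof -
  have tdrop: "tdrop (Node Atom acc) (enc_nat m) = enc_nat (m - 1 - length (dec acc))" for acc m
  proof -
    have "dec (tdrop (Node Atom acc) (enc_nat m)) = dec (enc_nat (m - 1 - length (dec acc)))" by simp
    thus ?thesis by (metis enc_list_dec)
  qed
  have *: "dec (fold (\<lambda>u acc. Node (Node (tdrop (Node Atom acc) (enc_nat m)) u) acc) ys acc) =
      rev (map (\<lambda>(i, y). Node (enc_nat (m - 1 - i)) y) (List.enumerate (length (dec acc)) ys)) @ dec acc"
    for m ys acc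
    by (induction ys arbitrary: acc) (auto simp: tdrop)
  have "dec (number (enc_nat (length js)) (enc_list (map enc_nat (rev js)))) =
      rev (map (\<lambda>(i, y). Node (enc_nat (length js - 1 - i)) y) (List.enumerate 0 (map enc_nat (rev js))))"
    using *[of "length js" "map enc_nat (rev js)" Atom] by (simp add: number_def)
  also have "\<dots> = map (\<lambda>(j, u). Node (enc_nat j) (enc_nat u)) (List.enumerate 0 js)"
    by (rule nth_equalityI) (auto simp: rev_nth nth_enumerate_eq)
  finally show ?thesis by (metis enc_list_dec)
qed

lemma thd_enc_edge [simp]: "thd (enc_edge k e) = enc_nat (fst e)"
  by (simp add: enc_edge_def split: prod.splits)

lemma thd_ttl_enc_edge [simp]: "thd (ttl (enc_edge k e)) = enc_nat (fst (snd e))"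
  by (simp add: enc_edge_def split: prod.splits)

lemma Node_ttl_enc_edge: "Node (enc_nat j) (ttl (enc_edge k e)) = enc_edge k (j, snd e)"
  by (simp add: enc_edge_def split: prod.splits)

lemma copy_edges_spec:
  "copy_edges (enc_list (map (enc_edge k) es)) (enc_list (map (\<lambda>(j, u). Node (enc_nat j) (enc_nat u)) (List.enumerate 0 js))) =
    enc_list (rev (map (enc_edge k) (copies es js)))"
proof -
  have edges_of: "dec (edges_of (enc_list (map (enc_edge k) es)) (Node (enc_nat j) (enc_nat u)) acc) =
      rev (map (enc_edge k) (map (\<lambda>e. (j, snd e)) (filter (\<lambda>e. fst e = u) es))) @ dec acc" for j u acc
    unfolding edges_of_def dec_fold_Node_if
    by (simp add: teq_iff filter_map o_def Node_ttl_enc_edge)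
  have "dec (fold (edges_of (enc_list (map (enc_edge k) es))) (map (\<lambda>(j, u). Node (enc_nat j) (enc_nat u)) ps) acc) =
      rev (map (enc_edge k) (concat (map (\<lambda>(j, u). map (\<lambda>e. (j, snd e)) (filter (\<lambda>e. fst e = u) es)) ps))) @ dec acc"
    for ps acc
    by (induction ps arbitrary: acc) (auto simp: edges_of)
  from this[of "List.enumerate 0 js" Atom] show ?thesis
    unfolding copy_edges_def copies_def by (metis append_Nil2 dec.simps(1) dec_enc_list enc_list_dec)
qed

lemma length_degree_at:
  "length (dec (degree_at (enc_nat v) (enc_list (rev (map (enc_edge k) es))))) = deg_in es v"
  unfolding degree_at_def dec_fold_Node_if deg_in_def
  by (simp add: teq_iff filter_map o_def flip: rev_filter rev_map)

text \<open>Folding with \<open>Node\<close> reverses once more, so the reversed output of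
  \<open>copy_edges\<close> returns to the order of \<open>copies\<close>; degrees do not depend on
  the order.\<close>

lemma prune_spec:
  "prune t (enc_list (rev (map (enc_edge k) es))) =
    enc_list (map (enc_edge k) (filter (\<lambda>e. deg_in es (fst (snd e)) \<le> length (dec t)) es))"
proof -
  have "dec (prune t (enc_list (rev (map (enc_edge k) es)))) =
    map (enc_edge k) (filter (\<lambda>e. deg_in es (fst (snd e)) \<le> length (dec t)) es)"
    unfolding prune_def dec_fold_Node_if
    by (simp add: tle_iff filter_map o_def length_degree_at flip: rev_filter rev_map)
  thus ?thesis by (metis enc_list_dec)
qed

lemma length_degree_zero: "length (dec (degree_zero (enc_list (map (enc_edge k) es)))) = length (filter (\<lambda>e. fst e = 0) es)"
  unfolding degree_zero_def dec_fold_Node_if by (simp add: filter_map o_def)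

lemma unit_weights_spec: "unit_weights (enc_nat m) = enc_list (map enc_bits (replicate m [True]))"
proof -
  have *: "fold (\<lambda>_. Node t) (replicate m Atom) (enc_list (replicate i t)) = enc_list (replicate (m + i) t)" for i t
    by (induction m arbitrary: i) (auto simp flip: enc_list.simps(2) replicate_Suc add_Suc_right)
  have "enc_bits [True] = Node (Node Atom Atom) Atom" by (simp add: enc_bits_def)
  with *[of "Node (Node Atom Atom) Atom" 0] show ?thesis by (simp add: unit_weights_def)
qed

lemma encodes_uniform:
  assumes "mu H = pmf_of_set {..<nleft H}" "0 < nleft H"
    and "y = enc_list [enc_nat (nleft H), enc_nat (nright H), enc_nat (alphabet H),
               enc_list (map (enc_edge (alphabet H)) (edges H)), unit_weights (enc_nat (nleft H))]"
  shows "encodes y H"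
  unfolding encodes_def Let_def
proof (intro exI conjI)
  show "length (replicate (nleft H) [True]) = nleft H" by simp
  show "y = enc_list [enc_nat (nleft H), enc_nat (nright H), enc_nat (alphabet H),
               enc_list (map (enc_edge (alphabet H)) (edges H)), enc_list (map enc_bits (replicate (nleft H) [True]))]"
    unfolding assms(3) unit_weights_spec ..
  show "\<forall>u<nleft H. pmf (mu H) u = real (bits_val (replicate (nleft H) [True] ! u)) /
      real (\<Sum>u'<nleft H. bits_val (replicate (nleft H) [True] ! u'))"
    using assms by (auto simp: pmf_of_set lessThan_empty_iff)
qed

subsection \<open>Correctness of the reduction\<close>

locale encoded_instance =
  fixes x :: tree and G :: sbug and ws :: "bool list list"
  assumes G: "sbug_instance G"
    and length_ws: "length ws = nleft G"
    and pmf_mu: "\<And>u. u < nleft G \<Longrightarrow>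
      pmf (mu G) u = real (bits_val (ws ! u)) / real (\<Sum>u'<nleft G. bits_val (ws ! u'))"
    and x: "x = enc_list [enc_nat (nleft G), enc_nat (nright G), enc_nat (alphabet G),
               enc_list (map (enc_edge (alphabet G)) (edges G)), enc_list (map enc_bits ws)]"
begin

abbreviation "weight u \<equiv> bits_val (ws ! u)"

definition "total_weight = (\<Sum>u<nleft G. weight u)"

definition "cumul = prefix_sums (width (inst_ws x)) (inst_ws x)"

definition "nbits = length (dec (thd cumul))"

lemma inst_simps [simp]:
  "inst_nl x = enc_nat (nleft G)" "inst_nr x = enc_nat (nright G)" "inst_k x = enc_nat (alphabet G)"
  "inst_es x = enc_list (map (enc_edge (alphabet G)) (edges G))" "inst_ws x = enc_list (map enc_bits ws)"
  by (simp_all add: x)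

lemma finite_mu: "finite (set_pmf (mu G))"
  using G finite_subset by (auto simp: sbug_instance_def)

lemma nleft_pos: "0 < nleft G"
  using G set_pmf_not_empty[of "mu G"] by (cases "nleft G") (auto simp: sbug_instance_def)

lemma total_pos: "0 < total_weight"
proof (rule ccontr)
  assume "\<not> 0 < total_weight"
  hence "pmf (mu G) u = 0" if "u < nleft G" for u using pmf_mu[OF that] by (simp add: total_weight_def)
  moreover obtain u where "u \<in> set_pmf (mu G)" using set_pmf_not_empty[of "mu G"] by blast
  ultimately show False using G by (auto simp: sbug_instance_def set_pmf_iff subset_iff)
qed

lemma sum_list_take_weight:
  assumes "i \<le> nleft G"
  shows "(\<Sum>t\<leftarrow>take i (map enc_bits ws). val t) = (\<Sum>j<i. weight j)"
  using assms length_ws by (simp add: sum_list_sum_nth val_enc_bits lessThan_atLeast0 min_def)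

lemma cumul_spec:
  "val (thd cumul) = total_weight"
  "map val (dec cumul) = rev (map (\<lambda>i. \<Sum>j\<le>i. weight j) [0..<nleft G])"
  "canonical (thd cumul)"
proof -
  have *: "(\<Sum>t\<leftarrow>map enc_bits ws. val t) < 2 ^ length (dec (width (inst_ws x)))"
    using sum_val_less_width[of "inst_ws x"] by simp
  have "map (\<lambda>i. \<Sum>t\<leftarrow>take (Suc i) (map enc_bits ws). val t) [0..<nleft G] = map (\<lambda>i. \<Sum>j\<le>i. weight j) [0..<nleft G]"
    by (rule map_cong) (auto simp: sum_list_take_weight lessThan_Suc_atMost simp del: take_Suc)
  thus "val (thd cumul) = total_weight" "map val (dec cumul) = rev (map (\<lambda>i. \<Sum>j\<le>i. weight j) [0..<nleft G])"
    using prefix_sums_spec[OF *] sum_list_take_weight[of "nleft G"] length_ws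
    by (simp_all add: cumul_def total_weight_def)
  obtain vs v where "map enc_bits ws = vs @ [v]"
    using length_ws nleft_pos by (metis length_greater_0_conv length_map rev_exhaust)
  thus "canonical (thd cumul)"
    by (simp add: cumul_def prefix_sums_snoc canonical_tadd)
qed

lemma nbits_bounds: "total_weight < 2 ^ nbits" "2 ^ nbits \<le> 2 * total_weight" "nbits \<le> size x"
proof -
  show "total_weight < 2 ^ nbits" "2 ^ nbits \<le> 2 * total_weight"
    using canonical_bounds(1,2)[OF cumul_spec(3)] total_pos by (simp_all add: cumul_spec nbits_def)
  have "val (thd cumul) < 2 ^ length (dec (width (inst_ws x)))"
    using sum_val_less_width[of "inst_ws x"] sum_list_take_weight[of "nleft G"] length_ws
    by (simp add: cumul_spec total_weight_def)
  hence "nbits \<le> length (dec (width (inst_ws x)))"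
    unfolding nbits_def by (rule canonical_bounds(3)[OF cumul_spec(3)])
  also have "\<dots> \<le> size (inst_ws x)" by (rule length_width_le)
  also have "\<dots> \<le> size x" by (simp add: x)
  finally show "nbits \<le> size x" .
qed

text \<open>All prefix sums are at most the total weight and so fit into \<open>nbits\<close> bits;
  truncation in the comparison therefore affects only the tape.\<close>

lemma rank_cumul:
  "rank (thd cumul) (enc_bits bs) cumul = enc_nat (draw weight (nleft G) (bits_val (take nbits bs)))"
proof -
  have "length (filter (\<lambda>t. t mod 2 ^ nbits \<le> bits_val (take nbits bs)) (map val (dec cumul))) =
     length (filter (\<lambda>i. (\<Sum>j\<le>i. weight j) mod 2 ^ nbits \<le> bits_val (take nbits bs)) [0..<nleft G])"
    by (simp add: cumul_spec filter_map o_def flip: rev_filter)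
  also have "\<dots> = length (filter (\<lambda>i. (\<Sum>j\<le>i. weight j) \<le> bits_val (take nbits bs)) [0..<nleft G])"
  proof (intro arg_cong[where f = length] filter_cong refl)
    fix i assume "i \<in> set [0..<nleft G]"
    hence "(\<Sum>j\<le>i. weight j) \<le> total_weight" unfolding total_weight_def by (intro sum_mono2) auto
    hence "(\<Sum>j\<le>i. weight j) < 2 ^ nbits" using nbits_bounds(1) by linarith
    thus "((\<Sum>j\<le>i. weight j) mod 2 ^ nbits \<le> bits_val (take nbits bs)) = ((\<Sum>j\<le>i. weight j) \<le> bits_val (take nbits bs))"
      by simp
  qed
  also have "\<dots> = draw weight (nleft G) (bits_val (take nbits bs))"
    by (simp add: draw_def distinct_length_filter) (rule arg_cong[where f = card], auto)
  finally show ?thesis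
    by (simp add: rank_spec val_enc_bits_mod nbits_def[symmetric])
qed

definition "draw_pmf = map_pmf (\<lambda>bs. draw weight (nleft G) (bits_val bs)) (pmf_of_set {bs. length bs = nbits})"

lemma finite_draw_pmf: "finite (set_pmf draw_pmf)"
  by (simp add: draw_pmf_def set_pmf_of_set[OF bit_lists_nonempty finite_bit_lists] finite_bit_lists)

text \<open>Exactly \<open>weight u\<close> of the \<open>2 ^ nbits\<close> equally likely numbers
  lead to \<open>u\<close>. The common factor is the \<open>r\<close> of
  \<open>prob_rejection\<close>.\<close>

lemma pmf_draw_pmf:
  assumes "u < nleft G"
  shows "pmf draw_pmf u = total_weight / 2 ^ nbits * pmf (mu G) u"
proof -
  have "map_pmf bits_val (pmf_of_set {bs. length bs = nbits}) = pmf_of_set {..<2 ^ nbits}"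
    by (rule map_pmf_of_set_bij_betw[OF bij_betw_bits_val bit_lists_nonempty finite_bit_lists])
  hence "draw_pmf = map_pmf (draw weight (nleft G)) (pmf_of_set {..<2 ^ nbits})"
    by (simp add: draw_pmf_def flip: map_pmf_comp)
  hence "pmf draw_pmf u = card {R. R < 2 ^ nbits \<and> draw weight (nleft G) R = u} / 2 ^ nbits"
    by (simp add: pmf_map measure_pmf_of_set lessThan_empty_iff Int_def vimage_def)
  also have "card {R. R < 2 ^ nbits \<and> draw weight (nleft G) R = u} = weight u"
    using assms nbits_bounds(1) by (intro card_draw_eq) (auto simp: total_weight_def)
  also have "weight u / 2 ^ nbits = total_weight / 2 ^ nbits * pmf (mu G) u"
    using assms total_pos by (simp add: pmf_mu total_weight_def[symmetric])
  finally show ?thesis .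
qed

lemma prob_draw_accepted: "1 / 2 \<le> measure_pmf.prob draw_pmf {u. u < nleft G}"
proof -
  have "measure_pmf.prob draw_pmf {u. u < nleft G} = (\<Sum>u<nleft G. pmf draw_pmf u)"
    by (simp add: measure_measure_pmf_finite lessThan_def)
  also have "\<dots> = total_weight / 2 ^ nbits * (\<Sum>u<nleft G. pmf (mu G) u)"
    by (simp add: pmf_draw_pmf sum_distrib_left)
  also have "(\<Sum>u<nleft G. pmf (mu G) u) = 1"
    using G by (intro sum_pmf_eq_1) (auto simp: sbug_instance_def)
  also have "1 / 2 \<le> total_weight / 2 ^ nbits * (1 :: real)"
  proof -
    have "real (2 ^ nbits) \<le> real (2 * total_weight)" using nbits_bounds(2) by (rule of_nat_mono)
    thus ?thesis by (simp add: field_simps)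
  qed
  finally show ?thesis .
qed

definition "ell c = c * length (dec (binary (enc_nat (alphabet G - 1))))"

lemma rate_eq: "rate c x = enc_nat (ell c)"
proof -
  have "ttl (enc_nat k) = enc_nat (k - 1)" for k by (cases k) (auto simp: enc_nat_def)
  thus ?thesis by (simp add: rate_def tmult_enc_nat_left ell_def)
qed

lemma sample_count_eq: "sample_count c x = enc_nat (ell c * nright G)"
  by (simp add: sample_count_def rate_eq tmult_enc_nat_left)

lemma run_samples_eq:
  "run_samples c x (enc_bits bs) = enc_list (map enc_nat (rev (take (ell c * nright G)
     (filter (\<lambda>u. u < nleft G) (draws weight (nleft G) nbits (8 * (ell c * nright G)) bs)))))"
proof -
  have "prefix_sums (width (inst_ws x)) (inst_ws x) = cumul" by (simp only: cumul_def)
  thus ?thesis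
    using sample_loop[OF rank_cumul[unfolded nbits_def], where m = "ell c * nright G"
        and M = "8 * (ell c * nright G)" and bs = bs and acc = "[]"]
    unfolding run_samples_def Let_def samples_def
    by (simp add: fold_ignore sample_count_eq tmult_enc_nat_left nbits_def[symmetric] mult.commute del: inst_simps(5))
qed

lemma left_degree_zero:
  assumes "left_regular d G"
  shows "length (filter (\<lambda>e. fst e = 0) (edges G)) = d"
  using assms nleft_pos by (simp add: left_regular_def flip: left_degree_eq)

lemma sampled_output_encodes:
  assumes "left_regular d G" "length js = ell c * nright G" "js \<noteq> []"
  shows "encodes (sampled_output c x (enc_list (map enc_nat (rev js)))) (sparsify (5 * ell c * d) G js)"
proof (rule encodes_uniform)
  let ?H = "sparsify (5 * ell c * d) G js"
  have T: "length (dec (threshold c x)) = 5 * ell c * d"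
    using assms(1) by (simp add: threshold_def rate_eq length_degree_zero left_degree_zero)
  show "sampled_output c x (enc_list (map enc_nat (rev js))) =
      enc_list [enc_nat (nleft ?H), enc_nat (nright ?H), enc_nat (alphabet ?H),
               enc_list (map (enc_edge (alphabet ?H)) (edges ?H)), unit_weights (enc_nat (nleft ?H))]"
    using number_spec[of js]
    by (simp add: sampled_output_def sample_count_eq assms(2) copy_edges_spec prune_spec T sparsify_def)
qed (use assms(3) in \<open>auto simp: sparsify_def\<close>)

text \<open>For alphabet size \<open>1\<close> the degree bound is \<open>0\<close>, so the output must not have any edges.\<close>

definition "trivial_sbug = \<lparr>nleft = 1, nright = 0, alphabet = alphabet G, edges = [], mu = pmf_of_set {..<1}\<rparr>"

lemma trivial_output_encodes: "encodes (trivial_output x) trivial_sbug"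
  by (rule encodes_uniform) (auto simp: trivial_sbug_def trivial_output_def enc_nat_Suc enc_nat_def)

lemma bounded_degree_trivial: "bounded_degree_output d D G trivial_sbug"
  using G by (auto simp: bounded_degree_output_def trivial_sbug_def sbug_instance_def left_degree_def
    set_pmf_of_set lessThan_empty_iff)

definition "samples_of c bs = take (ell c * nright G)
  (filter (\<lambda>u. u < nleft G) (draws weight (nleft G) nbits (8 * (ell c * nright G)) bs))"

lemma reduction_eq:
  "reduction c x (enc_bits bs) =
    (if 0 < ell c * nright G \<and> length (samples_of c bs) = ell c * nright G
     then sampled_output c x (enc_list (map enc_nat (rev (samples_of c bs)))) else trivial_output x)"
proof -
  have "ell c * nright G \<le> length (samples_of c bs) \<longleftrightarrow> length (samples_of c bs) = ell c * nright G"
    by (auto simp: samples_of_def)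
  thus ?thesis
    by (auto simp: reduction_def Let_def sample_count_eq tle_iff run_samples_eq samples_of_def[symmetric])
qed

lemma set_samples_of: "set (samples_of c bs) \<subseteq> {..<nleft G}"
  unfolding samples_of_def by (auto dest: in_set_takeD)

lemma reduction_bounded:
  assumes "left_regular d G" "real (5 * ell c * d) \<le> D"
  shows "\<exists>H. encodes (reduction c x (enc_bits bs)) H \<and> bounded_degree_output d D G H"
proof (cases "0 < ell c * nright G \<and> length (samples_of c bs) = ell c * nright G")
  case True
  hence "samples_of c bs \<noteq> []" by auto
  thus ?thesis
    using True sampled_output_encodes[OF assms(1), of "samples_of c bs" c]
      bounded_degree_sparsify[OF G assms(1) _ set_samples_of assms(2)]
    by (auto simp: reduction_eq)
next
  case False
  thus ?thesis using trivial_output_encodes bounded_degree_trivial by (auto simp: reduction_eq)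
qed

section \<open>Size parameters and degenerate instances\<close>

definition "label_bits = length (dec (binary (enc_nat (alphabet G - 1))))"

lemma ell_eq: "ell c = c * label_bits"
  by (simp add: ell_def label_bits_def)

lemma label_bits:
  shows label_bits_eq_0_iff: "label_bits = 0 \<longleftrightarrow> alphabet G = 1"
    and ln_le_label_bits: "ln (alphabet G) \<le> label_bits"
    and label_bits_le_ln: "label_bits \<le> 3 * ln (alphabet G)"
    and label_bits_le: "label_bits \<le> alphabet G"
proof -
  let ?k = "alphabet G" and ?t = "binary (enc_nat (alphabet G - 1))"
  have k: "0 < ?k" using G by (simp add: sbug_instance_def)
  have "(label_bits = 0 \<longleftrightarrow> ?k = 1) \<and> ln ?k \<le> label_bits \<and> label_bits \<le> 3 * ln ?k \<and> label_bits \<le> ?k"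
  proof (cases "?k = 1")
    case True
    thus ?thesis by (simp add: label_bits_def binary_def enc_nat_def)
  next
    case False
    with k have k2: "2 \<le> ?k" by simp
    hence t: "val ?t = ?k - 1" "canonical ?t"
      using binary_spec[of "enc_nat (?k - 1)"] by auto
    have up: "?k \<le> 2 ^ label_bits"
      using canonical_bounds(1)[OF t(2)] t(1) unfolding label_bits_def by simp
    \<comment> \<open>Continuing to the square of \<open>?k\<close> gives
      \<open>label_bits * ln 2 \<le> 2 * ln ?k\<close>; with \<open>ln 2 \<ge> 2/3\<close> this is
      the factor 3.\<close>
    have "2 ^ label_bits \<le> 2 * (?k - 1)"
      using canonical_bounds(2)[OF t(2)] t(1) k2 unfolding label_bits_def by simp
    also have "\<dots> \<le> ?k * ?k" using k2 by (intro mult_le_mono) auto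
    finally have low: "2 ^ label_bits \<le> ?k * ?k" .
    have "label_bits \<le> ?k"
      unfolding label_bits_def using canonical_bounds(3)[OF t(2), of ?k] t(1) less_exp[of ?k] by linarith
    moreover have "label_bits \<noteq> 0" using up k2 by (cases label_bits) auto
    moreover have "ln ?k \<le> label_bits"
    proof -
      have "real ?k \<le> real (2 ^ label_bits)" using up by (rule of_nat_mono)
      hence "ln ?k \<le> ln (real (2 ^ label_bits))" using k by (intro ln_mono) auto
      also have "\<dots> = label_bits * ln 2" by (simp add: ln_realpow)
      also have "\<dots> \<le> real label_bits * 1" using ln2_le_25_over_36 by (intro mult_left_mono) auto
      finally show ?thesis by simp
    qed
    moreover have "label_bits \<le> 3 * ln ?k"
    proof -
      have "real (2 ^ label_bits) \<le> real (?k * ?k)" using low by (rule of_nat_mono)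
      hence "ln (real (2 ^ label_bits)) \<le> ln (real (?k * ?k))" using k by (intro ln_mono) auto
      hence "label_bits * ln 2 \<le> 2 * ln ?k" using k by (simp add: ln_realpow ln_mult)
      moreover have "label_bits * (2 / 3) \<le> label_bits * ln 2"
        using ln2_ge_two_thirds by (intro mult_left_mono) auto
      ultimately show ?thesis by simp
    qed
    ultimately show ?thesis using False by simp
  qed
  thus "label_bits = 0 \<longleftrightarrow> ?k = 1" "ln ?k \<le> label_bits" "label_bits \<le> 3 * ln ?k" "label_bits \<le> ?k"
    by blast+
qed

text \<open>With one label or no constraints, the constant labeling satisfies everything. So in the
  cases where the edgeless output is forced, soundness is vacuous.\<close>

lemma not_no_instance:
  assumes "alphabet G = 1 \<or> nright G = 0" "0 \<le> \<gamma>"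
  shows "\<not> no_instance \<gamma> G"
proof
  assume no: "no_instance \<gamma> G"
  have "p 0 = 0" if "(u, v, p) \<in> set (edges G)" for u v p
  proof -
    have "v < nright G" "bij_betw p {..<alphabet G} {..<alphabet G}"
      using G that by (auto simp: sbug_instance_def)
    thus ?thesis using assms(1) by (auto simp: bij_betw_def lessThan_Suc)
  qed
  hence "{u. all_satisfied G (\<lambda>_. 0) u} = UNIV" by (auto simp: all_satisfied_def)
  moreover have "labeling G (\<lambda>_. 0)" using G by (auto simp: labeling_def sbug_instance_def)
  ultimately have "measure_pmf.prob (mu G) UNIV < 1 - \<gamma>" using no by (auto simp: no_instance_def)
  thus False using assms(2) by simp
qed

lemma completeness_trivial: "0 \<le> \<epsilon> \<Longrightarrow> completeness \<epsilon> G trivial_sbug"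
  unfolding completeness_def
proof (intro impI exI conjI)
  assume "0 \<le> \<epsilon>"
  show "{0} \<subseteq> {..<nleft trivial_sbug}" by (simp add: trivial_sbug_def)
  show "1 - 4 * \<epsilon> \<le> measure_pmf.prob (mu trivial_sbug) {0}"
    using \<open>0 \<le> \<epsilon>\<close> prob_uniform_lessThan[of 1 "{0}"] by (simp add: trivial_sbug_def)
  show "labeling trivial_sbug (\<lambda>_. 0)"
    using G by (auto simp: labeling_def trivial_sbug_def sbug_instance_def)
  show "\<forall>u\<in>{0}. all_satisfied trivial_sbug (\<lambda>_. 0) u"
    by (simp add: all_satisfied_def trivial_sbug_def)
qed

text \<open>Of the failure probability, \<open>1 / K\<close> is for collecting too few samples; the
  remaining \<open>13 / K\<close> transfers from independent samples of \<open>mu G\<close> to the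
  accepted draws by \<open>prob_rejection\<close>.\<close>

lemma prob_reduction:
  assumes d: "left_regular d G" "right_uniform d G" and D: "real (5 * ell c * d) \<le> D"
    and \<epsilon>: "0 < \<epsilon>" "\<epsilon> < 1" "\<epsilon>\<^sup>2 \<le> \<gamma>" and K: "72 \<le> K" "K \<le> c * \<epsilon>\<^sup>2"
    and N: "8 * (ell c * nright G) * nbits \<le> N"
  shows "1 - 14 / K \<le> measure_pmf.prob (map_pmf (\<lambda>r. reduction c x (enc_bits r)) (pmf_of_set {r. length r = N}))
     {y. \<exists>H. encodes y H \<and> bounded_degree_output d D G H \<and> completeness \<epsilon> G H \<and> soundness \<gamma> G H}"
    (is "_ \<le> measure_pmf.prob _ ?Good")
proof -
  let ?U = "pmf_of_set {r :: bool list. length r = N}"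
  let ?m = "ell c * nright G"
  have \<gamma>: "0 \<le> \<gamma>" using \<epsilon> by (smt (verit) zero_le_power2)
  have c: "0 < c" using K by (cases c) auto
  show ?thesis
  proof (cases "?m = 0")
    case True
    hence "\<not> no_instance \<gamma> G"
      using c \<gamma> by (intro not_no_instance) (auto simp: ell_eq label_bits_eq_0_iff)
    hence "trivial_output x \<in> ?Good"
      using trivial_output_encodes bounded_degree_trivial completeness_trivial \<epsilon> by (auto simp: soundness_def)
    hence "(\<lambda>r. reduction c x (enc_bits r)) -` ?Good = UNIV"
      using True by (auto simp only: reduction_eq vimage_def split: if_splits)
    thus ?thesis using K by simp
  next
    case False
    hence b: "0 < label_bits" and n: "0 < nright G" by (auto simp: ell_eq)
    let ?T = "5 * (c * label_bits) * d"
    define Bad where "Bad = {js. \<not> (completeness \<epsilon> G (sparsify ?T G js) \<and> soundness \<gamma> G (sparsify ?T G js))}"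
    let ?f = "filter (\<lambda>u. u < nleft G)"
    define B where "B = {xs. length (?f xs) < ?m} \<union> {xs. ?m \<le> length (?f xs) \<and> take ?m (?f xs) \<in> Bad}"
    let ?draws = "draws weight (nleft G) nbits (8 * ?m)"
    have good: "reduction c x (enc_bits r) \<in> ?Good" if "?draws r \<notin> B" for r
    proof -
      have len: "length (samples_of c r) = ?m" and "samples_of c r \<notin> Bad"
        using that by (auto simp: B_def samples_of_def)
      hence cs: "completeness \<epsilon> G (sparsify ?T G (samples_of c r))" "soundness \<gamma> G (sparsify ?T G (samples_of c r))"
        by (auto simp: Bad_def)
      have ne: "samples_of c r \<noteq> []" using len False by auto
      have "encodes (reduction c x (enc_bits r)) (sparsify ?T G (samples_of c r))"
        using sampled_output_encodes[OF d(1) len ne] len False by (simp add: reduction_eq ell_eq mult.assoc)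
      moreover have "bounded_degree_output d D G (sparsify ?T G (samples_of c r))"
        using D by (intro bounded_degree_sparsify G d ne set_samples_of) (simp add: ell_eq mult.assoc)
      ultimately show ?thesis using cs by blast
    qed
    have "measure_pmf.prob (map_pmf ?draws ?U) B \<le> 14 / K"
    proof -
      have "map_pmf ?draws ?U = replicate_pmf (8 * ?m) draw_pmf"
        using map_pmf_draws[OF N] by (simp add: draw_pmf_def)
      moreover have "measure_pmf.prob (replicate_pmf (8 * ?m) draw_pmf) {xs. length (?f xs) < ?m} \<le> exp (- real ?m)"
        by (rule prob_few_accepted[OF finite_draw_pmf prob_draw_accepted])
      moreover have "exp (- real ?m) \<le> 1 / K"
      proof -
        have "c * \<epsilon>\<^sup>2 \<le> real c * 1" using \<epsilon> by (intro mult_left_mono) (auto simp: power_le_one)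
        also have "\<dots> = real (c * 1)" by simp
        also have "\<dots> \<le> real (c * (label_bits * nright G))"
          using b n by (intro of_nat_mono) (simp add: Suc_leI)
        finally have "K \<le> real ?m" using K by (simp add: ell_eq mult.assoc)
        hence "exp (- real ?m) \<le> exp (- K)" by simp
        also have "\<dots> \<le> 1 / K" using K by (intro exp_neg_le_inverse) auto
        finally show ?thesis .
      qed
      moreover have "measure_pmf.prob (replicate_pmf (8 * ?m) draw_pmf)
          {xs. ?m \<le> length (?f xs) \<and> take ?m (?f xs) \<in> Bad} \<le> 13 / K"
      proof -
        have "measure_pmf.prob (replicate_pmf (8 * ?m) draw_pmf)
          {xs. ?m \<le> length (filter (\<lambda>u. u \<in> {..<nleft G}) xs) \<and> take ?m (filter (\<lambda>u. u \<in> {..<nleft G}) xs) \<in> Bad}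
          \<le> measure_pmf.prob (replicate_pmf ?m (mu G)) Bad"
          using G by (intro prob_rejection[where r = "total_weight / 2 ^ nbits"] finite_draw_pmf finite_mu)
            (auto simp: pmf_draw_pmf sbug_instance_def)
        also have "\<dots> \<le> 13 / K"
          using prob_sparsify_fails[OF G d ln_le_label_bits b n \<epsilon> K] by (simp add: Bad_def ell_eq)
        finally show ?thesis by simp
      qed
      ultimately show ?thesis
        unfolding B_def using measure_Un_le[of "{xs. length (?f xs) < ?m}" "replicate_pmf (8 * ?m) draw_pmf"
          "{xs. ?m \<le> length (?f xs) \<and> take ?m (?f xs) \<in> Bad}"] by simp
    qed
    hence "measure_pmf.prob ?U {r. ?draws r \<in> B} \<le> 14 / K"
      by (simp add: vimage_def)
    hence "1 - 14 / K \<le> measure_pmf.prob ?U {r. ?draws r \<notin> B}"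
      using prob_Collect_not[of ?U "\<lambda>r. ?draws r \<in> B"] by simp
    also have "\<dots> \<le> measure_pmf.prob ?U ((\<lambda>r. reduction c x (enc_bits r)) -` ?Good)"
      using good by (intro measure_pmf.finite_measure_mono) auto
    finally show ?thesis by simp
  qed
qed

text \<open>The tape needs at most \<open>8 * c\<close> times the cube of the input size. For size
  at least 2 the constant is absorbed by the power \<open>8 * c\<close>, otherwise by the additive
  term.\<close>

lemma tape_length:
  assumes "e = 8 * c + 3"
  shows "8 * (ell c * nright G) * nbits \<le> size x ^ e + e"
proof -
  have size_enc_nat: "size (enc_nat n) = n" for n
    unfolding enc_nat_def by (induction n) auto
  have "alphabet G \<le> size x" "nright G \<le> size x" by (simp_all add: x size_enc_nat)
  hence "8 * (ell c * nright G) * nbits \<le> 8 * (c * size x * size x) * size x"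
    unfolding ell_eq using nbits_bounds(3) label_bits_le by (intro mult_le_mono) auto
  also have "\<dots> = 8 * c * size x ^ 3" by (simp add: power3_eq_cube)
  also have "\<dots> \<le> size x ^ e + e"
  proof (cases "size x \<le> 1")
    case True
    hence "size x ^ 3 \<le> 1" by (rule power_le_one[OF zero_le])
    hence "8 * c * size x ^ 3 \<le> 8 * c * 1" by (rule mult_le_mono2)
    thus ?thesis unfolding assms by linarith
  next
    case False
    have "8 * c \<le> 2 ^ (8 * c)" by (rule less_imp_le[OF less_exp])
    also have "\<dots> \<le> size x ^ (8 * c)" using False by (intro power_mono) auto
    finally have "8 * c * size x ^ 3 \<le> size x ^ (8 * c) * size x ^ 3" by (rule mult_le_mono1)
    thus ?thesis unfolding assms power_add by linarith
  qed
  finally show ?thesis .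
qed

end

lemma encodes_imp_encoded_instance:
  assumes "sbug_instance G" "encodes x G"
  obtains ws where "encoded_instance x G ws"
  using assms unfolding encodes_def encoded_instance_def Let_def by blast

theorem theorem9p3:
  fixes \<delta> :: real
  assumes "0 < \<delta>"
  shows "\<exists>C :: real. C > 0 \<and>
    (\<forall>\<gamma> \<epsilon> :: real. 0 < \<gamma> \<and> \<gamma> < 1 \<and> 0 < \<epsilon> \<and> \<epsilon> < 1 \<and> \<gamma> \<ge> \<epsilon>\<^sup>2 \<longrightarrow>
      (\<exists>A :: tree \<Rightarrow> tree pmf. efficient_randomized A \<and>
        (\<forall>(G :: sbug) (d :: nat) (x :: tree).
           promise_instance \<epsilon> \<gamma> G \<and> left_regular d G \<and> right_uniform d G \<and> encodes x G \<longrightarrow>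
           (let l = C * (1 / \<epsilon>\<^sup>2) * ln (real (alphabet G));
                D = C * real d * l
            in (\<forall>y \<in> set_pmf (A x). \<exists>H. encodes y H \<and> bounded_degree_output d D G H) \<and>
               measure_pmf.prob (A x)
                 {y. \<exists>H. encodes y H \<and> bounded_degree_output d D G H \<and>
                         completeness \<epsilon> G H \<and> soundness \<gamma> G H} \<ge> 1 - \<delta>))))"
proof -
  \<comment> \<open>At least 72 for the tail bounds, and large enough that the failure probability
    \<open>14 / K\<close> is at most \<delta>.\<close>
  define K where "K = 72 + 14 / \<delta>"
  have K: "72 \<le> K" "14 / K \<le> \<delta>" using assms by (auto simp: K_def field_simps)
  show ?thesis
  \<comment> \<open>The threshold is 5 times \<open>c * label_bits * d\<close>, where
    \<open>c\<close> is at most \<open>2 * K\<close> over the square of \<epsilon> and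
    \<open>label_bits\<close> at most 3 times the logarithm: \<open>5 * 2 * 3 = 30\<close>. The
    constant enters the degree bound twice; one factor suffices, and the other is at least
    1.\<close>
  proof (intro exI[of _ "30 * K"] conjI allI impI, goal_cases)
    case 1
    show ?case using K by simp
  next
    case (2 \<gamma> \<epsilon>)
    define c where "c = nat \<lceil>K / \<epsilon>\<^sup>2\<rceil>"
    define e where "e = 8 * c + 3"
    define A where "A x = map_pmf (\<lambda>r. reduction c x (enc_bits r)) (pmf_of_set {r. length r = size x ^ e + e})" for x
    have \<epsilon>: "0 < \<epsilon>\<^sup>2" "\<epsilon>\<^sup>2 \<le> 1" using 2 by (auto simp: power_le_one)
    have "K / \<epsilon>\<^sup>2 \<le> real c" unfolding c_def by linarith
    hence c: "K \<le> c * \<epsilon>\<^sup>2" using \<epsilon> by (simp add: field_simps)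
    have c': "real c \<le> 2 * K / \<epsilon>\<^sup>2"
    proof -
      have "1 \<le> K / \<epsilon>\<^sup>2" using K \<epsilon> by (simp add: field_simps)
      moreover have "real c \<le> K / \<epsilon>\<^sup>2 + 1" using \<open>1 \<le> K / \<epsilon>\<^sup>2\<close> unfolding c_def by linarith
      ultimately show ?thesis by simp
    qed
    show ?case
    proof (intro exI[of _ A] conjI allI impI, goal_cases)
      case 1
      show ?case unfolding efficient_randomized_def A_def
        using polynomial_time_reduction[of c]
        by (intro exI[of _ "\<lambda>z. reduction c (thd z) (ttl z)"] exI[of _ e]) simp
    next
      case (2 G d x)
      hence inst: "sbug_instance G" "left_regular d G" "right_uniform d G" "encodes x G"
        by (auto simp: promise_instance_def)
      obtain ws where "encoded_instance x G ws"
        using encodes_imp_encoded_instance[OF inst(1,4)] .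
      then interpret encoded_instance x G ws .
      define D where "D = 30 * K * real d * (30 * K * (1 / \<epsilon>\<^sup>2) * ln (real (alphabet G)))"
      have ln: "0 \<le> ln (real (alphabet G))" using inst(1) by (simp add: sbug_instance_def)
      have "real (5 * ell c * d) = 5 * real c * real label_bits * real d" by (simp add: ell_eq)
      also have "\<dots> \<le> 5 * (2 * K / \<epsilon>\<^sup>2) * (3 * ln (alphabet G)) * real d"
        using c' label_bits_le_ln K \<epsilon> by (intro mult_right_mono mult_mono) auto
      also have "\<dots> = 1 * real d * (30 * K * (1 / \<epsilon>\<^sup>2) * ln (real (alphabet G)))" by simp
      also have "\<dots> \<le> D"
        unfolding D_def using K \<epsilon> ln by (intro mult_right_mono) auto
      finally have D: "real (5 * ell c * d) \<le> D" .
      have "\<forall>y \<in> set_pmf (A x). \<exists>H. encodes y H \<and> bounded_degree_output d D G H"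
        using reduction_bounded[OF inst(2) D] by (auto simp: A_def)
      moreover have "1 - 14 / K \<le> measure_pmf.prob (A x)
                 {y. \<exists>H. encodes y H \<and> bounded_degree_output d D G H \<and>
                         completeness \<epsilon> G H \<and> soundness \<gamma> G H}"
        unfolding A_def using \<open>0 < \<gamma> \<and> _\<close> K c
        by (intro prob_reduction inst D tape_length e_def) auto
      ultimately show ?case
        using K(2) unfolding Let_def D_def[symmetric] by (intro conjI) auto
    qed
  qed
qed

end
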